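(* Let $k$ be an algebraically closed field of characteristic zero. Let $\mathbf{S}_5(1),\mathbf{S}_5(2),\mathbf{S}_5(3)\subset PGL_4(k)$ be the subgroups (each isomorphic to the symmetric group $\mathbf{S}_5$) and $g_0,g_1,f_0,f_1\in k[x,y,z,t]$ the quartic forms defined in the context. For a subgroup $G$ of $PGL_4(k)$, a quartic surface $V(f)$ is called $G$-invariant if $\mathrm{Paut}(V(f))$ contains a subgroup conjugate to $G$ in $PGL_4(k)$. (1) Any $\mathbf{S}_5(3)$-invariant quartic surface is singular. (2) An $\mathbf{S}_5(1)$-invariant nonsingular quartic surface is, up to projective equivalence, $V(g_0+\lambda g_1)$ for some $\lambda\in k$. (3) An $\mathbf{S}_5(2)$-invariant nonsingular quartic surface is, up to projective equivalence, $V(f_0)$ or $V(f_1)$.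
   Context: $k$ is algebraically closed of characteristic $0$; $i\in k$ satisfies $i^2=-1$; $\sqrt2,\sqrt3,\sqrt5\in k$ are fixed square roots, $\sqrt{15}=\sqrt3\sqrt5$, $\omega=(-1+i\sqrt3)/2$, $\nu_\pm=(\sqrt3\pm i\sqrt5)/(2\sqrt2)$. For $A\in GL_4(k)$, $(A)$ denotes its class in $PGL_4(k)$. For a quartic form $f$ (nonzero, homogeneous of degree 4 in $x,y,z,t$), the quartic surface is $V(f)=\{(a)\in P^3: f(a)=0\}$; $V(f)$ is singular at $(a)\in V(f)$ if all first partial derivatives of $f$ vanish at $a$, and nonsingular if it has no singular point. $\mathrm{Paut}(V(f))=\{(A)\in PGL_4(k): (A)V(f)=V(f)\}$. Two quartic surfaces $V,V'$ are projectively equivalent if $V'=(A)V$ for some $(A)\in PGL_4(k)$. The groups: $\mathbf{S}_5(m)$ ($m=1,2,3$) is the image of the faithful representation $\Phi_m:\mathbf{S}_5\to PGL_4(k)$ with $\Phi_m((123))=(R_{m1})$, $\Phi_m((12)(34))=(R_{m2})$, $\Phi_m((12)(45))=(R_{m3})$, $\Phi_m((12))=(R_{m4})$; equivalently, $\mathbf{S}_5(m)$ is the subgroup generated by $(R_{m1}),(R_{m2}),(R_{m3}),(R_{m4})$, where $R_{11}=R_{21}=\mathrm{diag}(1,1,\omega,\omega^2)$, $R_{31}=\mathrm{diag}(\omega,\omega,\omega^2,\omega^2)$, $$R_{12}=\begin{pmatrix}1&0&0&0\\0&-\frac13&\frac23&\frac23\\0&\frac23&-\frac13&\frac23\\0&\frac23&\frac23&-\frac13\end{pmatrix},\quad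 R_{13}=\begin{pmatrix}-\frac14&\frac{\sqrt{15}}4&0&0\\\frac{\sqrt{15}}4&\frac14&0&0\\0&0&0&1\\0&0&1&0\end{pmatrix},\quad R_{14}=\begin{pmatrix}1&0&0&0\\0&1&0&0\\0&0&0&1\\0&0&1&0\end{pmatrix},$$ $$R_{22}=\frac1{\sqrt3}\begin{pmatrix}1&0&0&\sqrt2\\0&-1&\sqrt2&0\\0&\sqrt2&1&0\\\sqrt2&0&0&-1\end{pmatrix},\quad R_{23}=\begin{pmatrix}\frac{\sqrt3}2&\frac12&0&0\\\frac12&-\frac{\sqrt3}2&0&0\\0&0&0&1\\0&0&1&0\end{pmatrix},\quad R_{24}=\begin{pmatrix}0&1&0&0\\-1&0&0&0\\0&0&0&1\\0&0&-1&0\end{pmatrix},$$ $$R_{32}=\frac1{\sqrt3}\begin{pmatrix}1&0&0&\sqrt2\\0&1&\sqrt2&0\\0&\sqrt2&-1&0\\\sqrt2&0&0&-1\end{pmatrix},\quad R_{33}=\begin{pmatrix}0&0&0&\nu_+\\0&0&\nu_-&0\\0&\nu_+&0&0\\\nu_-&0&0&0\end{pmatrix},\quad R_{34}=\begin{pmatrix}0&0&1&0\\0&0&0&-1\\1&0&0&0\\0&-1&0&0\end{pmatrix}.$$ The forms: $g_0=-x^4+2\sqrt{15}(y^3+z^3+t^3)x+10(z^3+t^3)y+13x^2y^2+5z^2t^2+(26x^2+20y^2)zt-6\sqrt{15}xyzt$, $g_1=x^4+y^4+2x^2y^2+4z^2t^2+4(x^2+y^2)zt$, $f_0=x^4+y^4-2\sqrt3x^3y+2\sqrt3y^3x+2\sqrt2\sqrt3z^3x-2\sqrt2z^3y+2\sqrt2t^3x+2\sqrt2\sqrt3t^3y+6x^2y^2+6z^2t^2-6\sqrt3x^2zt+6\sqrt3y^2zt-12xyzt$,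 $f_1=x^4-y^4+\frac2{\sqrt3}x^3y+\frac2{\sqrt3}y^3x+2\frac{\sqrt2}{\sqrt3}z^3x+2\sqrt2z^3y+2\sqrt2t^3x-2\frac{\sqrt2}{\sqrt3}t^3y+2\sqrt3(x^2zt+y^2zt)$. *)

theory Defs
  imports
    "HOL-Analysis.Analysis"
    "HOL-Algebra.Generated_Groups"
    "HOL-Computational_Algebra.Polynomial"
    "HOL-Library.Poly_Mapping"
begin

section \<open>Polynomials in four variables\<close>

text \<open>
  The ring k[x,y,z,t] is the monoid algebra of the exponent vectors \<^typ>\<open>4 \<Rightarrow>\<^sub>0 nat\<close>.
  The variables x, y, z, t carry the indices 1, 2, 3, 4 of the type \<^typ>\<open>4\<close>
  (where 4 = 0), the same indices as the coordinates of \<open>'k ^ 4\<close>.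
\<close>

type_synonym 'k poly4 = "(4 \<Rightarrow>\<^sub>0 nat) \<Rightarrow>\<^sub>0 'k"

definition Var :: "4 \<Rightarrow> 'k::field poly4" where
  "Var v = Poly_Mapping.single (Poly_Mapping.single v 1) 1"

definition Const :: "'k::field \<Rightarrow> 'k poly4" where
  "Const c = Poly_Mapping.single 0 c"

definition eval4 :: "'k::field poly4 \<Rightarrow> 'k ^ 4 \<Rightarrow> 'k" where
  "eval4 f a = (\<Sum>m\<in>Poly_Mapping.keys f. Poly_Mapping.lookup f m * (\<Prod>v\<in>UNIV. (a $ v) ^ Poly_Mapping.lookup m v))"

text \<open>
  When \<open>v\<close> does not occur in the monomial \<open>m\<close>, the truncated exponent
  subtraction is harmless, since the coefficient \<open>of_nat (Poly_Mapping.lookup m v)\<close> vanishes.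
\<close>

definition pderiv4 :: "4 \<Rightarrow> 'k::field poly4 \<Rightarrow> 'k poly4" where
  "pderiv4 v f = (\<Sum>m\<in>Poly_Mapping.keys f.
     Poly_Mapping.single (m - Poly_Mapping.single v 1) (of_nat (Poly_Mapping.lookup m v) * Poly_Mapping.lookup f m))"

definition quartic_form :: "'k::field poly4 \<Rightarrow> bool" where
  "quartic_form f \<longleftrightarrow> f \<noteq> 0 \<and> (\<forall>m\<in>Poly_Mapping.keys f. (\<Sum>v\<in>UNIV. Poly_Mapping.lookup m v) = 4)"


section \<open>The projective linear group and projective space\<close>

definition GL4 :: "('k::field ^ 4 ^ 4) monoid" where
  "GL4 = \<lparr>carrier = {A. invertible A}, mult = (**), one = mat 1\<rparr>"

definition scalars4 :: "('k::field ^ 4 ^ 4) set" where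
  "scalars4 = {mat c | c. c \<noteq> 0}"

definition PGL4 :: "('k::field ^ 4 ^ 4) set monoid" where
  "PGL4 = GL4 Mod scalars4"

definition pclass :: "'k::field ^ 4 ^ 4 \<Rightarrow> ('k ^ 4 ^ 4) set" where
  "pclass A = scalars4 #>\<^bsub>GL4\<^esub> A"

text \<open>A point of projective space is the set of its nonzero representing vectors.\<close>

definition ppoint :: "'k::field ^ 4 \<Rightarrow> ('k ^ 4) set" where
  "ppoint a = {c *s a | c. c \<noteq> 0}"

definition pact :: "('k::field ^ 4 ^ 4) set \<Rightarrow> ('k ^ 4) set \<Rightarrow> ('k ^ 4) set" where
  "pact C p = {A *v a | A a. A \<in> C \<and> a \<in> p}"

definition zero_locus :: "'k::field poly4 \<Rightarrow> ('k ^ 4) set set" where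
  "zero_locus f = {ppoint a | a. a \<noteq> 0 \<and> eval4 f a = 0}"

text \<open>
  Singularity refers to the form \<open>f\<close> and not only to the point set \<open>V(f)\<close>:
  every point of a multiple component is singular.
\<close>

definition singular_at :: "'k::field poly4 \<Rightarrow> 'k ^ 4 \<Rightarrow> bool" where
  "singular_at f a \<longleftrightarrow> a \<noteq> 0 \<and> eval4 f a = 0 \<and> (\<forall>v. eval4 (pderiv4 v f) a = 0)"

definition nonsingular_form :: "'k::field poly4 \<Rightarrow> bool" where
  "nonsingular_form f \<longleftrightarrow> (\<nexists>a. singular_at f a)"

definition Paut :: "('k::field ^ 4) set set \<Rightarrow> ('k ^ 4 ^ 4) set set" where
  "Paut V = {C \<in> carrier PGL4. pact C ` V = V}"

definition proj_equivalent :: "('k::field ^ 4) set set \<Rightarrow> ('k ^ 4) set set \<Rightarrow> bool" where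
  "proj_equivalent V V' \<longleftrightarrow> (\<exists>C\<in>carrier PGL4. V' = pact C ` V)"

definition conjugate_subgroups ::
    "('k::field ^ 4 ^ 4) set set \<Rightarrow> ('k ^ 4 ^ 4) set set \<Rightarrow> bool" where
  "conjugate_subgroups G H \<longleftrightarrow>
     (\<exists>P\<in>carrier PGL4. H = (\<lambda>C. P \<otimes>\<^bsub>PGL4\<^esub> C \<otimes>\<^bsub>PGL4\<^esub> inv\<^bsub>PGL4\<^esub> P) ` G)"

definition group_invariant ::
    "('k::field ^ 4 ^ 4) set set \<Rightarrow> ('k ^ 4) set set \<Rightarrow> bool" where
  "group_invariant G V \<longleftrightarrow>
     (\<exists>H. subgroup H PGL4 \<and> H \<subseteq> Paut V \<and> conjugate_subgroups G H)"

lemma group_GL4: "group (GL4 :: ('k::field ^ 4 ^ 4) monoid)"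
proof (rule groupI)
  fix A :: "'k ^ 4 ^ 4" assume "A \<in> carrier GL4"
  then obtain B where "A ** B = mat 1" "B ** A = mat 1"
    by (auto simp: GL4_def invertible_def)
  then show "\<exists>B\<in>carrier GL4. B \<otimes>\<^bsub>GL4\<^esub> A = \<one>\<^bsub>GL4\<^esub>"
    by (auto simp: GL4_def invertible_def)
next
  have "invertible (mat 1 :: 'k ^ 4 ^ 4)"
    unfolding invertible_def by (rule exI[of _ "mat 1"]) simp
  then show "\<one>\<^bsub>GL4\<^esub> \<in> carrier (GL4 :: ('k ^ 4 ^ 4) monoid)"
    by (simp add: GL4_def)
qed (simp_all add: GL4_def invertible_mult matrix_mul_assoc)

lemma mat_mult_entry: "(mat c ** A) $ i $ j = c * (A :: 'k::field ^ 4 ^ 4) $ i $ j"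
  by (simp add: matrix_matrix_mult_def mat_def if_distrib if_distribR sum.delta cong: if_cong)

lemma mult_mat_entry: "(A ** mat c) $ i $ j = (A :: 'k::field ^ 4 ^ 4) $ i $ j * c"
  by (simp add: matrix_matrix_mult_def mat_def if_distrib if_distribR sum.delta' cong: if_cong)

lemma mat_mult_commute: "mat c ** A = A ** mat c" for A :: "'k::field ^ 4 ^ 4"
  by (simp add: vec_eq_iff mat_mult_entry mult_mat_entry)

lemma mat_mult_mat: "mat c ** mat d = (mat (c * d) :: 'k::field ^ 4 ^ 4)"
  by (simp add: vec_eq_iff mat_mult_entry) (simp add: mat_def)

lemma normal_scalars4: "(scalars4 :: ('k::field ^ 4 ^ 4) set) \<lhd> GL4"
proof -
  interpret group "GL4 :: ('k ^ 4 ^ 4) monoid" by (rule group_GL4)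
  have carr: "(scalars4 :: ('k ^ 4 ^ 4) set) \<subseteq> carrier GL4"
  proof
    fix A :: "'k ^ 4 ^ 4" assume "A \<in> scalars4"
    then obtain c where c: "c \<noteq> 0" "A = mat c" by (auto simp: scalars4_def)
    have "A ** mat (inverse c) = mat 1 \<and> mat (inverse c) ** A = mat 1"
      using c by (simp add: mat_mult_mat)
    then show "A \<in> carrier GL4" by (auto simp: GL4_def invertible_def)
  qed
  have "subgroup (scalars4 :: ('k ^ 4 ^ 4) set) GL4"
  proof (rule subgroupI[OF carr])
    show "(scalars4 :: ('k ^ 4 ^ 4) set) \<noteq> {}"
      by (auto simp: scalars4_def intro: exI[of _ 1])
  next
    fix A :: "'k ^ 4 ^ 4" assume A: "A \<in> scalars4"
    then obtain c where c: "c \<noteq> 0" "A = mat c" by (auto simp: scalars4_def)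
    have B: "mat (inverse c) \<in> (scalars4 :: ('k ^ 4 ^ 4) set)" using c by (auto simp: scalars4_def)
    have "inv\<^bsub>GL4\<^esub> A = mat (inverse c)"
    proof (rule inv_equality)
      show "mat (inverse c) \<otimes>\<^bsub>GL4\<^esub> A = \<one>\<^bsub>GL4\<^esub>"
        using c by (simp add: GL4_def mat_mult_mat)
    qed (use A B carr in blast)+
    then show "inv\<^bsub>GL4\<^esub> A \<in> scalars4" using B by simp
  next
    fix A B :: "'k ^ 4 ^ 4" assume "A \<in> scalars4" "B \<in> scalars4"
    then show "A \<otimes>\<^bsub>GL4\<^esub> B \<in> scalars4"
      by (auto simp: scalars4_def GL4_def mat_mult_mat)
  qed
  moreover have "scalars4 #>\<^bsub>GL4\<^esub> A = A <#\<^bsub>GL4\<^esub> scalars4" for A :: "'k ^ 4 ^ 4"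
  proof -
    have "{mat c ** A | c. c \<noteq> 0} = {A ** mat c | c. c \<noteq> 0}"
      by (simp only: mat_mult_commute)
    then show ?thesis
      by (simp add: r_coset_def l_coset_def scalars4_def GL4_def) blast
  qed
  ultimately show ?thesis by (simp add: normal_def normal_axioms_def group_GL4)
qed

lemma group_PGL4: "group (PGL4 :: ('k::field ^ 4 ^ 4) set monoid)"
  unfolding PGL4_def by (rule normal.factorgroup_is_group[OF normal_scalars4])


section \<open>The three subgroups isomorphic to the symmetric group on five letters\<close>

text \<open>
  Throughout, \<open>i\<close>, \<open>s2\<close>, \<open>s3\<close>, \<open>s5\<close> stand for the fixed square roots of
  -1, 2, 3, 5.
\<close>

definition omega :: "'k::field \<Rightarrow> 'k \<Rightarrow> 'k" where
  "omega i s3 = (-1 + i * s3) / 2"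

definition nu_plus :: "'k::field \<Rightarrow> 'k \<Rightarrow> 'k \<Rightarrow> 'k \<Rightarrow> 'k" where
  "nu_plus i s2 s3 s5 = (s3 + i * s5) / (2 * s2)"

definition nu_minus :: "'k::field \<Rightarrow> 'k \<Rightarrow> 'k \<Rightarrow> 'k \<Rightarrow> 'k" where
  "nu_minus i s2 s3 s5 = (s3 - i * s5) / (2 * s2)"

definition mat4 :: "'k::field list list \<Rightarrow> 'k ^ 4 ^ 4" where
  "mat4 rs = vector (map vector rs)"

definition R11 :: "'k::field \<Rightarrow> 'k \<Rightarrow> 'k ^ 4 ^ 4" where
  "R11 i s3 = (let w = omega i s3 in mat4
     [[1, 0, 0, 0],
      [0, 1, 0, 0],
      [0, 0, w, 0],
      [0, 0, 0, w^2]])"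

definition R12 :: "'k::field ^ 4 ^ 4" where
  "R12 = mat4
     [[1,    0,    0,    0],
      [0, -1/3,  2/3,  2/3],
      [0,  2/3, -1/3,  2/3],
      [0,  2/3,  2/3, -1/3]]"

definition R13 :: "'k::field \<Rightarrow> 'k \<Rightarrow> 'k ^ 4 ^ 4" where
  "R13 s3 s5 = (let s15 = s3 * s5 in mat4
     [[ -1/4, s15/4, 0, 0],
      [s15/4,   1/4, 0, 0],
      [    0,     0, 0, 1],
      [    0,     0, 1, 0]])"

definition R14 :: "'k::field ^ 4 ^ 4" where
  "R14 = mat4
     [[1, 0, 0, 0],
      [0, 1, 0, 0],
      [0, 0, 0, 1],
      [0, 0, 1, 0]]"

definition R21 :: "'k::field \<Rightarrow> 'k \<Rightarrow> 'k ^ 4 ^ 4" where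
  "R21 i s3 = R11 i s3"

definition R22 :: "'k::field \<Rightarrow> 'k \<Rightarrow> 'k ^ 4 ^ 4" where
  "R22 s2 s3 = mat (1 / s3) ** mat4
     [[ 1,  0,  0, s2],
      [ 0, -1, s2,  0],
      [ 0, s2,  1,  0],
      [s2,  0,  0, -1]]"

definition R23 :: "'k::field \<Rightarrow> 'k ^ 4 ^ 4" where
  "R23 s3 = mat4
     [[s3/2,   1/2, 0, 0],
      [ 1/2, -s3/2, 0, 0],
      [   0,     0, 0, 1],
      [   0,     0, 1, 0]]"

definition R24 :: "'k::field ^ 4 ^ 4" where
  "R24 = mat4
     [[ 0, 1,  0, 0],
      [-1, 0,  0, 0],
      [ 0, 0,  0, 1],
      [ 0, 0, -1, 0]]"

definition R31 :: "'k::field \<Rightarrow> 'k \<Rightarrow> 'k ^ 4 ^ 4" where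
  "R31 i s3 = (let w = omega i s3 in mat4
     [[w, 0,   0,   0],
      [0, w,   0,   0],
      [0, 0, w^2,   0],
      [0, 0,   0, w^2]])"

definition R32 :: "'k::field \<Rightarrow> 'k \<Rightarrow> 'k ^ 4 ^ 4" where
  "R32 s2 s3 = mat (1 / s3) ** mat4
     [[ 1,  0,  0, s2],
      [ 0,  1, s2,  0],
      [ 0, s2, -1,  0],
      [s2,  0,  0, -1]]"

definition R33 :: "'k::field \<Rightarrow> 'k \<Rightarrow> 'k \<Rightarrow> 'k \<Rightarrow> 'k ^ 4 ^ 4" where
  "R33 i s2 s3 s5 = (let np = nu_plus i s2 s3 s5; nm = nu_minus i s2 s3 s5 in mat4
     [[ 0,  0,  0, np],
      [ 0,  0, nm,  0],
      [ 0, np,  0,  0],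
      [nm,  0,  0,  0]])"

definition R34 :: "'k::field ^ 4 ^ 4" where
  "R34 = mat4
     [[0,  0, 1,  0],
      [0,  0, 0, -1],
      [1,  0, 0,  0],
      [0, -1, 0,  0]]"

definition S5_1 :: "'k::field \<Rightarrow> 'k \<Rightarrow> 'k \<Rightarrow> ('k ^ 4 ^ 4) set set" where
  "S5_1 i s3 s5 = generate PGL4 (pclass ` {R11 i s3, R12, R13 s3 s5, R14})"

definition S5_2 :: "'k::field \<Rightarrow> 'k \<Rightarrow> 'k \<Rightarrow> ('k ^ 4 ^ 4) set set" where
  "S5_2 i s2 s3 = generate PGL4 (pclass ` {R21 i s3, R22 s2 s3, R23 s3, R24})"

definition S5_3 :: "'k::field \<Rightarrow> 'k \<Rightarrow> 'k \<Rightarrow> 'k \<Rightarrow> ('k ^ 4 ^ 4) set set" where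
  "S5_3 i s2 s3 s5 =
     generate PGL4 (pclass ` {R31 i s3, R32 s2 s3, R33 i s2 s3 s5, R34})"


section \<open>The quartic forms\<close>

definition form_g0 :: "'k::field \<Rightarrow> 'k \<Rightarrow> 'k poly4" where
  "form_g0 s3 s5 = (let x = Var 1; y = Var 2; z = Var 3; t = Var 4; s15 = s3 * s5 in
     - (x^4) + Const (2 * s15) * (y^3 + z^3 + t^3) * x + 10 * (z^3 + t^3) * y
     + 13 * x^2 * y^2 + 5 * z^2 * t^2 + (26 * x^2 + 20 * y^2) * z * t
     - Const (6 * s15) * x * y * z * t)"

definition form_g1 :: "'k::field poly4" where
  "form_g1 = (let x = Var 1; y = Var 2; z = Var 3; t = Var 4 in
     x^4 + y^4 + 2 * x^2 * y^2 + 4 * z^2 * t^2 + 4 * (x^2 + y^2) * z * t)"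

definition form_f0 :: "'k::field \<Rightarrow> 'k \<Rightarrow> 'k poly4" where
  "form_f0 s2 s3 = (let x = Var 1; y = Var 2; z = Var 3; t = Var 4 in
     x^4 + y^4 - Const (2 * s3) * x^3 * y + Const (2 * s3) * y^3 * x
     + Const (2 * s2 * s3) * z^3 * x - Const (2 * s2) * z^3 * y
     + Const (2 * s2) * t^3 * x + Const (2 * s2 * s3) * t^3 * y
     + 6 * x^2 * y^2 + 6 * z^2 * t^2
     - Const (6 * s3) * x^2 * z * t + Const (6 * s3) * y^2 * z * t
     - 12 * x * y * z * t)"

definition form_f1 :: "'k::field \<Rightarrow> 'k \<Rightarrow> 'k poly4" where
  "form_f1 s2 s3 = (let x = Var 1; y = Var 2; z = Var 3; t = Var 4 in
     x^4 - y^4 + Const (2 / s3) * x^3 * y + Const (2 / s3) * y^3 * x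
     + Const (2 * (s2 / s3)) * z^3 * x + Const (2 * s2) * z^3 * y
     + Const (2 * s2) * t^3 * x - Const (2 * (s2 / s3)) * t^3 * y
     + Const (2 * s3) * (x^2 * z * t + y^2 * z * t))"

end

theory Submission
  imports Defs
begin

text \<open>
  Let \<open>G\<close> be one of the three groups and let \<open>V(f)\<close> be a nonsingular \<open>G\<close>-invariant quartic surface.

  A projective transformation in the symmetry group preserves the point set \<open>V(f)\<close>. To make this a
  condition on \<open>f\<close> one needs a Nullstellensatz: a quartic form that vanishes on \<open>V(f)\<close> is a constant
  multiple of \<open>f\<close>. For nonsingular \<open>f\<close> this has a direct proof, \<open>form_vanishing_on_nonsingular_form\<close>: a
  form that violates it produces, by pseudo-division along parallel lines, a factorization of \<open>f\<close> near
  some line whose two factors vanish at a common point, which is then a singular point of \<open>f\<close>.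
  After a change of coordinates (\<open>invariant_surface_normal_form\<close>), \<open>f\<close> becomes a form \<open>g\<close> with
  \<open>g(R x) = c g(x)\<close> for each generator \<open>R\<close> of \<open>G\<close>, where \<open>c\<close> depends on \<open>R\<close>.

  The multipliers \<open>c\<close> are governed by the relations of the symmetric group. They are 1 on the
  alternating group and a sign on the transposition (\<open>multiplier_order_3\<close>,
  \<open>multipliers_alternating\<close>). The scalars by which the matrices may violate the relations have fourth
  power 1 and do not matter for quartics.

  It remains to solve linear equations for the coefficients of \<open>g\<close>. The 3-cycle is diagonal, so that its
  invariance selects monomials. For the third group the selected monomials are quadratic in \<open>x, y\<close>, and
  \<open>g\<close> is singular along a line (\<open>R31_invariant_double_line\<close>). For the first two groups 13 monomials
  survive (\<open>normal_form_R11\<close>). For the first group the remaining generators leave the pencil spanned by \<open>g\<^sub>0\<close>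
  and \<open>g\<^sub>1\<close> when the sign is positive (\<open>invariant_pencil\<close>) and nothing when it is negative
  (\<open>odd_R14_vanishes\<close>); the form \<open>g\<^sub>1\<close> is a square, hence singular (\<open>form_g1_singular\<close>). For the second
  group they leave the multiples of \<open>f\<^sub>0\<close> for the positive sign and those of \<open>f\<^sub>1\<close> for the negative one
  (\<open>R24_even_multiple_of_f0\<close>, \<open>R24_odd_multiple_of_f1\<close>).
\<close>

section \<open>Substitution homomorphisms\<close>

locale comm_ring_map =
  fixes \<phi> :: "'a::comm_ring_1 \<Rightarrow> 'b::comm_ring_1"
  assumes map_add: "\<phi> (x + y) = \<phi> x + \<phi> y"
    and map_mult: "\<phi> (x * y) = \<phi> x * \<phi> y"
    and map_one: "\<phi> 1 = 1"
begin

lemma map_zero: "\<phi> 0 = 0"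
  using map_add[of 0 0] by simp

lemma map_uminus: "\<phi> (- x) = - \<phi> x"
  using map_add[of x "- x"] map_zero by (simp add: eq_neg_iff_add_eq_0 add.commute)

lemma map_diff: "\<phi> (x - y) = \<phi> x - \<phi> y"
  using map_add[of x "- y"] map_uminus[of y] by simp

lemma map_sum: "\<phi> (sum f S) = (\<Sum>x\<in>S. \<phi> (f x))"
  by (induction S rule: infinite_finite_induct) (simp_all add: map_zero map_add)

lemma map_prod: "\<phi> (prod f S) = (\<Prod>x\<in>S. \<phi> (f x))"
  by (induction S rule: infinite_finite_induct) (simp_all add: map_one map_mult)

lemma map_power: "\<phi> (x ^ n) = \<phi> x ^ n"
  by (induction n) (simp_all add: map_one map_mult)

lemma map_numeral: "\<phi> (numeral n) = numeral n"
proof -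
  have "\<phi> (of_nat k) = of_nat k" for k
    by (induction k) (simp_all add: map_zero map_one map_add)
  from this[of "numeral n"] show ?thesis by simp
qed

lemmas map_simps = map_add map_diff map_uminus map_mult map_power map_zero map_one map_numeral

end

lemma comm_ring_map_id: "comm_ring_map (\<lambda>x::'a::comm_ring_1. x)"
  by unfold_locales auto

lemma comm_ring_map_const_poly: "comm_ring_map (\<lambda>c::'a::comm_ring_1. [:c:])"
  by unfold_locales auto

lemma comm_ring_map_poly: "comm_ring_map (\<lambda>p::'a::comm_ring_1 poly. poly p s)"
  by unfold_locales auto

lemma comm_ring_map_Const: "comm_ring_map (Const :: 'k::field \<Rightarrow> 'k poly4)"
  by unfold_locales (simp_all add: Const_def single_add mult_single)

definition subst_monom :: "(4 \<Rightarrow> 'r) \<Rightarrow> (4 \<Rightarrow>\<^sub>0 nat) \<Rightarrow> 'r::comm_ring_1" where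
  "subst_monom \<theta> m = (\<Prod>v\<in>UNIV. \<theta> v ^ Poly_Mapping.lookup m v)"

text \<open>
  The image of a polynomial in a \<open>k\<close>-algebra with structure map \<open>\<phi>\<close>. Evaluation,
  restriction to a line and linear substitution are all of this kind, for different algebras, so that
  they inherit their ring homomorphism laws and their compatibilities from one place.
\<close>

definition subst4 :: "('k::field \<Rightarrow> 'r::comm_ring_1) \<Rightarrow> (4 \<Rightarrow> 'r) \<Rightarrow> 'k poly4 \<Rightarrow> 'r" where
  "subst4 \<phi> \<theta> f = (\<Sum>m\<in>Poly_Mapping.keys f. \<phi> (Poly_Mapping.lookup f m) * subst_monom \<theta> m)"

lemma eval4_eq_subst4: "eval4 f a = subst4 (\<lambda>c. c) (($) a) f"
  by (simp add: eval4_def subst4_def subst_monom_def)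

lemma subst_monom_0: "subst_monom \<theta> 0 = 1"
  by (simp add: subst_monom_def)

lemma subst_monom_add: "subst_monom \<theta> (m + n) = subst_monom \<theta> m * subst_monom \<theta> n"
  by (simp add: subst_monom_def lookup_add power_add prod.distrib)

lemma subst_monom_single: "subst_monom \<theta> (Poly_Mapping.single v n) = \<theta> v ^ n"
proof -
  have "subst_monom \<theta> (Poly_Mapping.single v n) = (\<Prod>w\<in>UNIV. if v = w then \<theta> w ^ n else 1)"
    unfolding subst_monom_def by (intro prod.cong) (auto simp: lookup_single when_def)
  then show ?thesis by simp
qed

context comm_ring_map
begin

lemma map_subst_monom: "\<phi> (subst_monom \<theta> m) = subst_monom (\<lambda>v. \<phi> (\<theta> v)) m"
  by (simp add: subst_monom_def map_prod map_power)

lemma map_subst4: "\<phi> (subst4 \<psi> \<theta> f) = subst4 (\<lambda>c. \<phi> (\<psi> c)) (\<lambda>v. \<phi> (\<theta> v)) f"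
  by (simp add: subst4_def map_sum map_mult map_subst_monom)

end

lemma subst4_superset:
  assumes "finite S" "Poly_Mapping.keys f \<subseteq> S" and "comm_ring_map \<phi>"
  shows "subst4 \<phi> \<theta> f = (\<Sum>m\<in>S. \<phi> (Poly_Mapping.lookup f m) * subst_monom \<theta> m)"
  unfolding subst4_def using assms comm_ring_map.map_zero[OF assms(3)]
  by (intro sum.mono_neutral_left) (auto simp: in_keys_iff)

lemma subst4_single:
  assumes "comm_ring_map \<phi>"
  shows "subst4 \<phi> \<theta> (Poly_Mapping.single m c) = \<phi> c * subst_monom \<theta> m"
  using comm_ring_map.map_zero[OF assms] by (simp add: subst4_def)

lemma subst4_add:
  assumes "comm_ring_map \<phi>"
  shows "subst4 \<phi> \<theta> (f + g) = subst4 \<phi> \<theta> f + subst4 \<phi> \<theta> g"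
proof -
  let ?S = "Poly_Mapping.keys f \<union> Poly_Mapping.keys g"
  have "subst4 \<phi> \<theta> h = (\<Sum>m\<in>?S. \<phi> (Poly_Mapping.lookup h m) * subst_monom \<theta> m)"
    if "Poly_Mapping.keys h \<subseteq> ?S" for h
    by (rule subst4_superset[OF _ that assms]) simp
  from this[of f] this[of g] this[of "f + g"] show ?thesis
    using Poly_Mapping.keys_add[of f g]
    by (simp add: lookup_add comm_ring_map.map_add[OF assms] algebra_simps sum.distrib)
qed

lemma poly4_induct [case_names single add]:
  assumes "\<And>m c. P (Poly_Mapping.single m c)" and "\<And>f g. P f \<Longrightarrow> P g \<Longrightarrow> P (f + g)"
  shows "P (f :: 'k::field poly4)"
proof -
  have *: "P (\<Sum>m\<in>S. Poly_Mapping.single m (c m))" if "finite S" for S and c :: "(4 \<Rightarrow>\<^sub>0 nat) \<Rightarrow> 'k"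
    using that
  proof induction
    case empty
    show ?case using assms(1)[of 0 0] by simp
  qed (simp add: assms)
  have "(\<Sum>m\<in>Poly_Mapping.keys f. Poly_Mapping.single m (Poly_Mapping.lookup f m)) = f"
  proof (rule poly_mapping_eqI)
    fix n
    have "(\<Sum>m\<in>Poly_Mapping.keys f. Poly_Mapping.lookup f m when m = n)
        = (\<Sum>m\<in>Poly_Mapping.keys f. if m = n then Poly_Mapping.lookup f m else 0)"
      by (intro sum.cong) (auto simp: when_def)
    also have "\<dots> = Poly_Mapping.lookup f n"
      by (simp add: in_keys_iff)
    finally show "Poly_Mapping.lookup (\<Sum>m\<in>Poly_Mapping.keys f.
        Poly_Mapping.single m (Poly_Mapping.lookup f m)) n = Poly_Mapping.lookup f n"
      by (simp add: lookup_sum lookup_single)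
  qed
  then show ?thesis using *[OF finite_keys[of f], of "Poly_Mapping.lookup f"] by simp
qed

lemma subst4_mult:
  assumes "comm_ring_map \<phi>"
  shows "subst4 \<phi> \<theta> (f * g) = subst4 \<phi> \<theta> f * subst4 \<phi> \<theta> g"
proof (induction f rule: poly4_induct)
  case f: (single m c)
  show ?case
  proof (induction g rule: poly4_induct)
    case (single n d)
    show ?case
      by (simp add: mult_single subst4_single[OF assms] subst_monom_add
          comm_ring_map.map_mult[OF assms] algebra_simps)
  qed (simp add: distrib_left subst4_add[OF assms])
qed (simp add: distrib_right subst4_add[OF assms])

lemma comm_ring_map_subst4: "comm_ring_map \<phi> \<Longrightarrow> comm_ring_map (subst4 \<phi> \<theta>)"
proof (unfold_locales, goal_cases)
  case 3
  have "subst4 \<phi> \<theta> (Poly_Mapping.single 0 1) = 1"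
    using 3 by (simp only: subst4_single subst_monom_0 comm_ring_map.map_one mult_1)
  then show ?case by (simp only: single_one)
qed (simp_all add: subst4_add subst4_mult)

lemma subst4_Const: "comm_ring_map \<phi> \<Longrightarrow> subst4 \<phi> \<theta> (Const c) = \<phi> c"
  by (simp add: Const_def subst4_single subst_monom_0)

lemma subst4_Var: "comm_ring_map \<phi> \<Longrightarrow> subst4 \<phi> \<theta> (Var v) = \<theta> v"
  by (simp add: Var_def subst4_single subst_monom_single comm_ring_map.map_one)

lemma comm_ring_map_eval4: "comm_ring_map (\<lambda>f. eval4 f a)"
  unfolding eval4_eq_subst4 by (intro comm_ring_map_subst4 comm_ring_map_id)

lemma eval4_Const: "eval4 (Const c) a = c"
  by (simp add: eval4_eq_subst4 subst4_Const comm_ring_map_id)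

lemma eval4_Var: "eval4 (Var v) a = a $ v"
  by (simp add: eval4_eq_subst4 subst4_Var comm_ring_map_id)

lemmas eval4_simps = comm_ring_map.map_simps[OF comm_ring_map_eval4] eval4_Const eval4_Var

lemma eval4_subst4_Const: "eval4 (subst4 Const \<theta> f) a = eval4 f (\<chi> v. eval4 (\<theta> v) a)"
  by (simp add: comm_ring_map.map_subst4[OF comm_ring_map_eval4] eval4_Const)
    (simp add: eval4_eq_subst4 subst4_def subst_monom_def)


section \<open>Polynomials that vanish everywhere\<close>

lemma base_digits_eq:
  fixes N :: nat
  assumes "a + N * b = a' + N * b'" "a < N" "a' < N"
  shows "a = a'" "b = b'"
proof -
  have "(a + N * b) mod N = (a' + N * b') mod N" "(a + N * b) div N = (a' + N * b') div N"
    using assms(1) by auto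
  then show "a = a'" "b = b'" using assms(2,3) by auto
qed

text \<open>
  Kronecker substitution: with \<open>N\<close> above all exponents, replacing the variables by
  \<open>s\<close>, \<open>s^N\<close>, \<open>s^(N^2)\<close>, \<open>s^(N^3)\<close> sends distinct monomials of \<open>f\<close> to distinct powers of
  \<open>s\<close>, and a univariate polynomial that vanishes on an infinite field is zero.
\<close>

lemma eval4_zero_imp_zero:
  fixes f :: "'k::{field_char_0} poly4"
  assumes "\<And>a. eval4 f a = 0"
  shows "f = 0"
proof -
  define N where "N = Suc (\<Sum>m\<in>Poly_Mapping.keys f. \<Sum>v\<in>UNIV. Poly_Mapping.lookup m v)"
  define e :: "4 \<Rightarrow> nat" where
    "e = (\<lambda>v. if v = 1 then 1 else if v = 2 then N else if v = 3 then N * N else N * N * N)"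
  define code where "code m = (\<Sum>v\<in>UNIV. e v * Poly_Mapping.lookup m v)" for m
  have lt: "Poly_Mapping.lookup m v < N" if "m \<in> Poly_Mapping.keys f" for m v
  proof -
    have "Poly_Mapping.lookup m v \<le> (\<Sum>v\<in>UNIV. Poly_Mapping.lookup m v)"
      by (rule member_le_sum) auto
    also have "\<dots> \<le> (\<Sum>m\<in>Poly_Mapping.keys f. \<Sum>v\<in>UNIV. Poly_Mapping.lookup m v)"
      using that by (intro member_le_sum) auto
    finally show ?thesis by (simp add: N_def)
  qed
  have code: "code m = Poly_Mapping.lookup m 1 + N * (Poly_Mapping.lookup m 2
      + N * (Poly_Mapping.lookup m 3 + N * Poly_Mapping.lookup m 4))" for m
    by (simp add: code_def e_def sum_4 algebra_simps)
  have inj: "inj_on code (Poly_Mapping.keys f)"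
  proof (rule inj_onI, rule poly_mapping_eqI)
    fix m n v assume mn: "m \<in> Poly_Mapping.keys f" "n \<in> Poly_Mapping.keys f" "code m = code n"
    note 1 = base_digits_eq[OF mn(3)[unfolded code] lt[OF mn(1)] lt[OF mn(2)]]
    note 2 = base_digits_eq[OF 1(2) lt[OF mn(1)] lt[OF mn(2)]]
    note 3 = base_digits_eq[OF 2(2) lt[OF mn(1)] lt[OF mn(2)]]
    have "\<forall>v. Poly_Mapping.lookup m v = Poly_Mapping.lookup n v"
      unfolding forall_4 using 1 2 3 by blast
    then show "Poly_Mapping.lookup m v = Poly_Mapping.lookup n v" by blast
  qed
  define p where "p = (\<Sum>m\<in>Poly_Mapping.keys f. monom (Poly_Mapping.lookup f m) (code m))"
  have "poly p s = eval4 f (\<chi> v. s ^ e v)" for s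
    by (simp add: p_def poly_sum poly_monom eval4_def code_def power_sum power_mult)
  then have "p = 0" using assms by (simp add: poly_all_0_iff_0[symmetric])
  have "Poly_Mapping.lookup f m = 0" if "m \<in> Poly_Mapping.keys f" for m
  proof -
    have "coeff p (code m) = (\<Sum>n\<in>Poly_Mapping.keys f. if n = m then Poly_Mapping.lookup f n else 0)"
      unfolding p_def coeff_sum using inj that
      by (intro sum.cong) (auto simp: inj_on_eq_iff)
    then show ?thesis using that \<open>p = 0\<close> by simp
  qed
  then have "Poly_Mapping.lookup f m = 0" for m
    by (cases "m \<in> Poly_Mapping.keys f") (auto simp: in_keys_iff)
  then show ?thesis by (intro poly_mapping_eqI) simp
qed

lemma poly4_eqI:
  fixes f g :: "'k::{field_char_0} poly4"
  assumes "\<And>a. eval4 f a = eval4 g a"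
  shows "f = g"
  using eval4_zero_imp_zero[of "f - g"] assms by (simp add: eval4_simps)

section \<open>Singular points via restriction to lines\<close>

definition line_poly :: "'k::field poly4 \<Rightarrow> 'k ^ 4 \<Rightarrow> 'k ^ 4 \<Rightarrow> 'k poly" where
  "line_poly f a e = subst4 (\<lambda>c. [:c:]) (\<lambda>v. [:a $ v, e $ v:]) f"

lemma comm_ring_map_line_poly: "comm_ring_map (\<lambda>f. line_poly f a e)"
  unfolding line_poly_def by (intro comm_ring_map_subst4 comm_ring_map_const_poly)

lemma poly_line_poly: "poly (line_poly f a e) s = eval4 f (a + s *s e)"
  unfolding line_poly_def comm_ring_map.map_subst4[OF comm_ring_map_poly]
  by (simp add: eval4_eq_subst4 algebra_simps subst4_def subst_monom_def)

lemma coeff_0_line_poly: "coeff (line_poly f a e) 0 = eval4 f a"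
  using poly_line_poly[of f a e 0] by (simp add: poly_0_coeff_0)

lemma coeff_1_linear_power:
  "coeff ([:a, 1:] ^ n) (Suc 0) = of_nat n * (a::'a::idom) ^ (n - 1)"
proof -
  have "coeff (pderiv ([:a, 1:] ^ n)) 0 = poly (of_nat n * [:a, 1:] ^ (n - 1)) 0"
    by (simp add: pderiv_power pderiv_pCons poly_0_coeff_0 of_nat_poly)
  then show ?thesis by (simp add: coeff_pderiv poly_power)
qed

lemma coeff_1_line_poly_axis:
  "coeff (line_poly f a (axis v 1)) 1 = eval4 (pderiv4 v f) a"
proof -
  have pd: "eval4 (pderiv4 v f) a = (\<Sum>m\<in>Poly_Mapping.keys f.
      of_nat (Poly_Mapping.lookup m v) * Poly_Mapping.lookup f m
      * subst_monom (($) a) (m - Poly_Mapping.single v 1))"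
    unfolding pderiv4_def comm_ring_map.map_sum[OF comm_ring_map_eval4]
    by (simp add: eval4_eq_subst4 subst4_single comm_ring_map_id)
  have "coeff (subst_monom (\<lambda>w. [:a $ w, axis v 1 $ w:]) m) 1
      = of_nat (Poly_Mapping.lookup m v) * subst_monom (($) a) (m - Poly_Mapping.single v 1)" for m
  proof -
    define r where "r = (\<Prod>w\<in>UNIV - {v}. a $ w ^ Poly_Mapping.lookup m w)"
    have "(\<Prod>w\<in>UNIV - {v}. [:a $ w, axis v 1 $ w:] ^ Poly_Mapping.lookup m w)
        = (\<Prod>w\<in>UNIV - {v}. [:a $ w ^ Poly_Mapping.lookup m w:])"
      by (intro prod.cong) (auto simp: axis_def comm_ring_map.map_power[OF comm_ring_map_const_poly])
    then have "subst_monom (\<lambda>w. [:a $ w, axis v 1 $ w:]) m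
        = [:a $ v, 1:] ^ Poly_Mapping.lookup m v * [:r:]"
      by (simp add: subst_monom_def prod.remove[of UNIV v] axis_def r_def
          comm_ring_map.map_prod[OF comm_ring_map_const_poly])
    then have 1: "coeff (subst_monom (\<lambda>w. [:a $ w, axis v 1 $ w:]) m) 1
        = of_nat (Poly_Mapping.lookup m v) * a $ v ^ (Poly_Mapping.lookup m v - 1) * r"
      by (simp add: coeff_1_linear_power)
    have "(\<Prod>w\<in>UNIV - {v}. a $ w ^ Poly_Mapping.lookup (m - Poly_Mapping.single v 1) w) = r"
      unfolding r_def by (intro prod.cong) (auto simp: lookup_minus lookup_single when_def)
    then have "subst_monom (($) a) (m - Poly_Mapping.single v 1)
        = a $ v ^ (Poly_Mapping.lookup m v - 1) * r"
      by (simp add: subst_monom_def prod.remove[of UNIV v] lookup_minus)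
    then show ?thesis using 1 by (simp add: algebra_simps)
  qed
  then show ?thesis
    unfolding pd by (simp add: line_poly_def subst4_def coeff_sum algebra_simps)
qed

text \<open>
  The partial derivatives at \<open>a\<close> are the linear coefficients of the restrictions to the
  coordinate lines through \<open>a\<close>. Being singular is thus a statement about restrictions to lines, which
  are easily followed through products and through linear changes of coordinates.
\<close>

lemma singular_atI:
  assumes "a \<noteq> 0" "\<And>e. coeff (line_poly f a e) 0 = 0" "\<And>e. coeff (line_poly f a e) 1 = 0"
  shows "singular_at f a"
  unfolding singular_at_def
  using assms coeff_0_line_poly coeff_1_line_poly_axis by metis


section \<open>Homogeneous forms\<close>

definition form_of_degree :: "nat \<Rightarrow> 'k::field poly4 \<Rightarrow> bool" where
  "form_of_degree d f \<longleftrightarrow> (\<forall>m\<in>Poly_Mapping.keys f. (\<Sum>v\<in>UNIV. Poly_Mapping.lookup m v) = d)"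

lemma quartic_form_iff: "quartic_form f \<longleftrightarrow> f \<noteq> 0 \<and> form_of_degree 4 f"
  by (simp add: quartic_form_def form_of_degree_def)

lemma form_of_degree_0: "form_of_degree d 0"
  by (simp add: form_of_degree_def)

lemma form_of_degree_add:
  "form_of_degree d f \<Longrightarrow> form_of_degree d g \<Longrightarrow> form_of_degree d (f + g)"
  using Poly_Mapping.keys_add[of f g] by (auto simp: form_of_degree_def)

lemma form_of_degree_mult:
  "form_of_degree d f \<Longrightarrow> form_of_degree e g \<Longrightarrow> form_of_degree (d + e) (f * g)"
  using keys_mult[of f g] by (fastforce simp: form_of_degree_def lookup_add sum.distrib)

lemma form_of_degree_Const: "form_of_degree 0 (Const c)"
  by (simp add: form_of_degree_def Const_def)

lemma form_of_degree_Var: "form_of_degree 1 (Var v)"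
  by (simp add: form_of_degree_def Var_def lookup_single when_def)

lemma form_of_degree_Const_mult: "form_of_degree d f \<Longrightarrow> form_of_degree d (Const c * f)"
  using form_of_degree_mult[OF form_of_degree_Const, of d f c] by simp

lemma form_of_degree_diff:
  "form_of_degree d f \<Longrightarrow> form_of_degree d g \<Longrightarrow> form_of_degree d (f - g)"
  by (auto simp: form_of_degree_def in_keys_iff lookup_minus)

lemma form_of_degree_sum:
  "(\<And>x. x \<in> S \<Longrightarrow> form_of_degree d (f x)) \<Longrightarrow> form_of_degree d (sum f S)"
  by (induction S rule: infinite_finite_induct)
    (auto intro: form_of_degree_add form_of_degree_0)

lemma form_of_degree_power: "form_of_degree d f \<Longrightarrow> form_of_degree (d * n) (f ^ n)"
proof (induction n)
  case 0
  show ?case using form_of_degree_Const[of 1] by (simp add: Const_def)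
next
  case (Suc n)
  then show ?case using form_of_degree_mult[of d f "d * n" "f ^ n"] by simp
qed

lemma form_of_degree_prod:
  "(\<And>x. x \<in> S \<Longrightarrow> form_of_degree (d x) (f x)) \<Longrightarrow> form_of_degree (sum d S) (prod f S)"
proof (induction S rule: infinite_finite_induct)
  case (insert x S)
  then show ?case by (simp add: form_of_degree_mult)
qed (use form_of_degree_Const[of 1] in \<open>simp_all add: Const_def\<close>)

lemma eval4_scale:
  assumes "form_of_degree d f"
  shows "eval4 f (s *s a) = s ^ d * eval4 f a"
proof -
  have "subst_monom (($) (s *s a)) m = s ^ d * subst_monom (($) a) m"
    if "m \<in> Poly_Mapping.keys f" for m
    using that assms
    by (auto simp: subst_monom_def power_mult_distrib prod.distrib form_of_degree_def
        power_sum[symmetric])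
  then show ?thesis
    by (simp add: eval4_eq_subst4 subst4_def sum_distrib_left algebra_simps)
qed


section \<open>Forms that vanish on a nonsingular surface\<close>

lemma coeff_mult_at_degree_bounds:
  fixes p q :: "'a::comm_semiring_0 poly"
  assumes "degree p \<le> m" "degree q \<le> n"
  shows "coeff (p * q) (m + n) = coeff p m * coeff q n"
proof -
  have "coeff p i * coeff q (m + n - i) = 0" if "i \<noteq> m" "i \<le> m + n" for i
  proof (cases "i < m")
    case True
    then have "degree q < m + n - i" using assms(2) by linarith
    then show ?thesis by (simp add: coeff_eq_0)
  next
    case False
    then have "degree p < i" using assms(1) that by linarith
    then show ?thesis by (simp add: coeff_eq_0)
  qed
  then have "coeff (p * q) (m + n) = (\<Sum>i\<le>m + n. if i = m then coeff p m * coeff q n else 0)"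
    unfolding coeff_mult by (intro sum.cong) auto
  then show ?thesis by simp
qed

lemma prod_linear_powers:
  fixes x y :: "'i \<Rightarrow> 'r::comm_ring_1"
  assumes "finite S"
  shows "degree (\<Prod>v\<in>S. [:x v, y v:] ^ n v) \<le> sum n S"
    and "coeff (\<Prod>v\<in>S. [:x v, y v:] ^ n v) (sum n S) = (\<Prod>v\<in>S. y v ^ n v)"
proof -
  have pow: "degree ([:x v, y v:] ^ k) \<le> k \<and> coeff ([:x v, y v:] ^ k) k = y v ^ k" for v k
  proof (induction k)
    case (Suc k)
    have "degree [:x v, y v:] \<le> 1" by simp
    with Suc show ?case
      using coeff_mult_at_degree_bounds[of "[:x v, y v:]" 1 "[:x v, y v:] ^ k" k]
        degree_mult_le[of "[:x v, y v:]" "[:x v, y v:] ^ k"]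
      by simp
  qed simp
  have "degree (\<Prod>v\<in>S. [:x v, y v:] ^ n v) \<le> sum n S
      \<and> coeff (\<Prod>v\<in>S. [:x v, y v:] ^ n v) (sum n S) = (\<Prod>v\<in>S. y v ^ n v)"
    using assms
  proof (induction S)
    case (insert w S)
    then show ?case
      using pow[of w "n w"] coeff_mult_at_degree_bounds[of "[:x w, y w:] ^ n w" "n w"
          "\<Prod>v\<in>S. [:x v, y v:] ^ n v" "sum n S"]
        degree_mult_le[of "[:x w, y w:] ^ n w" "\<Prod>v\<in>S. [:x v, y v:] ^ n v"]
      by simp
  qed simp
  then show "degree (\<Prod>v\<in>S. [:x v, y v:] ^ n v) \<le> sum n S"
    and "coeff (\<Prod>v\<in>S. [:x v, y v:] ^ n v) (sum n S) = (\<Prod>v\<in>S. y v ^ n v)" by auto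
qed

text \<open>
  The polynomial \<open>f(x + s u)\<close> in \<open>k[x,y,z,t][s]\<close>. It collects the restrictions of \<open>f\<close> to all
  lines with direction \<open>u\<close>; the base point is redundant in the direction \<open>u\<close>, but in exchange no
  complement of \<open>u\<close> has to be chosen.
\<close>

definition sweep :: "'k::field ^ 4 \<Rightarrow> 'k poly4 \<Rightarrow> 'k poly4 poly" where
  "sweep u f = subst4 (\<lambda>c. [:Const c:]) (\<lambda>v. [:Var v, Const (u $ v):]) f"

lemma poly_sweep:
  "poly (sweep u f) (Const s) = subst4 Const (\<lambda>v. Var v + Const s * Const (u $ v)) f"
  unfolding sweep_def comm_ring_map.map_subst4[OF comm_ring_map_poly] by simp

lemma eval4_poly_sweep: "eval4 (poly (sweep u f) (Const s)) b = eval4 f (b + s *s u)"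
proof -
  have "(\<chi> v. eval4 (Var v + Const s * Const (u $ v)) b) = b + s *s u"
    by (simp add: vec_eq_iff eval4_simps)
  then show ?thesis by (simp add: poly_sweep eval4_subst4_Const)
qed

lemma line_poly_poly_sweep:
  "line_poly (poly (sweep u f) (Const s)) b e = line_poly f (b + s *s u) e"
proof -
  have "line_poly (Const c) b e = [:c:]" "line_poly (Var v) b e = [:b $ v, e $ v:]" for c v
    by (simp_all add: line_poly_def subst4_Const subst4_Var comm_ring_map_const_poly)
  then show ?thesis
    unfolding poly_sweep comm_ring_map.map_subst4[OF comm_ring_map_line_poly]
      comm_ring_map.map_add[OF comm_ring_map_line_poly]
      comm_ring_map.map_mult[OF comm_ring_map_line_poly]
    by (simp add: line_poly_def[of f] mult.commute)
qed

text \<open>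
  If \<open>f(u)\<close> is nonzero then, up to a unit, \<open>f(x + s u)\<close> is monic in \<open>s\<close>, so that its degree in \<open>s\<close>
  does not drop at any base point.
\<close>

lemma sweep_degree:
  assumes "form_of_degree d f"
  shows "degree (sweep u f) \<le> d" and "coeff (sweep u f) d = Const (eval4 f u)"
proof -
  have 1: "degree (subst_monom (\<lambda>v. [:Var v, Const (u $ v):]) m) \<le> d"
    "coeff (subst_monom (\<lambda>v. [:Var v, Const (u $ v):]) m) d = Const (subst_monom (($) u) m)"
    if "m \<in> Poly_Mapping.keys f" for m
    using that assms prod_linear_powers[of UNIV Var "\<lambda>v. Const (u $ v)" "Poly_Mapping.lookup m"]
    by (auto simp: subst_monom_def form_of_degree_def comm_ring_map.map_prod[OF comm_ring_map_Const]
        comm_ring_map.map_power[OF comm_ring_map_Const])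
  show "degree (sweep u f) \<le> d"
    unfolding sweep_def subst4_def
    by (intro degree_sum_le) (use 1 in \<open>auto intro: order.trans[OF degree_smult_le]\<close>)
  show "coeff (sweep u f) d = Const (eval4 f u)"
    by (simp add: sweep_def eval4_eq_subst4 subst4_def coeff_sum 1
        comm_ring_map.map_sum[OF comm_ring_map_Const] comm_ring_map.map_mult[OF comm_ring_map_Const])
qed

lemma (in comm_ring_map) map_poly_mult: "map_poly \<phi> (p * q) = map_poly \<phi> p * map_poly \<phi> q"
  by (rule poly_eqI) (simp add: coeff_map_poly map_zero coeff_mult map_sum map_mult)

lemma (in comm_ring_map) poly_map_poly: "poly (map_poly \<phi> p) (\<phi> x) = \<phi> (poly p x)"
proof (induction p)
  case (pCons a p)
  then show ?case by (simp add: map_poly_pCons map_zero map_add map_mult)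
qed (simp add: map_zero)

text \<open>
  The homogeneous Nullstellensatz for a nonsingular hypersurface, in equal degrees. Choose \<open>u\<close> with
  \<open>f(u) \<noteq> 0\<close> and subtract from \<open>h\<close> the multiple of \<open>f\<close> with the same value at \<open>u\<close>; the difference \<open>g\<close>
  vanishes on \<open>V(f)\<close> and at \<open>u\<close>, so \<open>g(x + s u)\<close> has degree less than \<open>d\<close> in \<open>s\<close>. Suppose \<open>g \<noteq> 0\<close>. Among the
  nonzero polynomials in \<open>k[x,y,z,t][s]\<close> that vanish wherever \<open>F = f(x + s u)\<close> vanishes, let \<open>E\<close> have
  least degree in \<open>s\<close>; this degree is less than \<open>d\<close>. Pseudo-division gives \<open>a F = E Q\<close> with \<open>a\<close> free of
  \<open>s\<close>, because the remainder also vanishes on the zeros of \<open>F\<close>. Over a base point where \<open>a \<noteq> 0\<close> the factor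
  \<open>Q\<close> has positive degree in \<open>s\<close>, hence a root; there \<open>F\<close> vanishes and therefore \<open>E\<close> does too. So \<open>a F\<close> is
  a product of two factors that vanish at that point, and \<open>f\<close> is singular there. This replaces
  factorization in a polynomial ring by one minimal choice.
\<close>

theorem form_vanishing_on_nonsingular_form:
  fixes f h :: "'k::{alg_closed_field, field_char_0} poly4"
  assumes f: "form_of_degree d f" "f \<noteq> 0" and ns: "nonsingular_form f"
    and h: "form_of_degree d h" and van: "\<And>a. eval4 f a = 0 \<Longrightarrow> eval4 h a = 0"
  shows "\<exists>c. h = Const c * f"
proof -
  obtain u where u: "eval4 f u \<noteq> 0"
    using eval4_zero_imp_zero[of f] f(2) by blast
  define c where "c = eval4 h u / eval4 f u"
  define g where "g = h - Const c * f"
  have g: "form_of_degree d g" "eval4 g u = 0"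
    using f(1) h u
    by (auto simp: g_def eval4_simps c_def intro: form_of_degree_diff form_of_degree_Const_mult)
  have gvan: "eval4 g a = 0" if "eval4 f a = 0" for a
    using that van[of a] by (simp add: g_def eval4_simps)
  have "g = 0"
  proof (rule ccontr)
    assume "g \<noteq> 0"
    define F where "F = sweep u f"
    have degF: "degree (map_poly (\<lambda>r. eval4 r b) F) = d" for b
    proof -
      have "coeff (map_poly (\<lambda>r. eval4 r b) F) d \<noteq> 0"
        using u sweep_degree[OF f(1), of u]
        by (simp add: F_def coeff_map_poly eval4_simps)
      then show ?thesis
        using le_degree map_poly_degree_leq[of "\<lambda>r. eval4 r b" F] sweep_degree(1)[OF f(1), of u]
        by (metis F_def antisym order.trans)
    qed
    have polyF: "poly (map_poly (\<lambda>r. eval4 r b) F) s = eval4 f (b + s *s u)" for b s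
      using comm_ring_map.poly_map_poly[OF comm_ring_map_eval4, of b F "Const s"]
      by (simp add: F_def eval4_poly_sweep eval4_Const)
    define V where "V E \<longleftrightarrow> (\<forall>b s. eval4 f (b + s *s u) = 0 \<longrightarrow> eval4 (poly E (Const s)) b = 0)"
      for E
    have G: "sweep u g \<noteq> 0 \<and> V (sweep u g)"
    proof -
      obtain b where "eval4 g b \<noteq> 0"
        using eval4_zero_imp_zero[of g] \<open>g \<noteq> 0\<close> by blast
      then have "sweep u g \<noteq> 0"
        using eval4_poly_sweep[of u g 0 b] by (auto simp: eval4_simps)
      then show ?thesis using gvan by (auto simp: V_def eval4_poly_sweep)
    qed
    then obtain E where E: "E \<noteq> 0" "V E" and
      min: "\<And>E'. E' \<noteq> 0 \<Longrightarrow> V E' \<Longrightarrow> degree E \<le> degree E'"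
      using ex_has_least_nat[of "\<lambda>E. E \<noteq> 0 \<and> V E" "sweep u g" degree] by blast
    have "d \<noteq> 0"
    proof
      assume "d = 0"
      then have "eval4 g a = 0" for a
        using eval4_scale[OF g(1), where s = 0 and a = a] eval4_scale[OF g(1), where s = 0 and a = u] g(2) by simp
      then show False using eval4_zero_imp_zero[of g] \<open>g \<noteq> 0\<close> by blast
    qed
    have "degree (sweep u g) \<noteq> d"
      using sweep_degree(2)[OF g(1), of u] g(2) G \<open>d \<noteq> 0\<close>
      by (metis Const_def leading_coeff_0_iff single_zero)
    then have degE: "degree E < d"
      using sweep_degree(1)[OF g(1), of u] min[of "sweep u g"] G by linarith
    obtain a Q r where aQ: "a \<noteq> 0" "smult a F = E * Q + r" and r: "r = 0 \<or> degree r < degree E"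
      using pseudo_mod[OF E(1), of F] by blast
    have "V r"
      unfolding V_def
    proof (intro allI impI)
      fix b s assume z: "eval4 f (b + s *s u) = 0"
      have "poly (smult a F) (Const s) = poly (E * Q + r) (Const s)"
        by (simp only: aQ)
      then have "poly r (Const s) = a * poly F (Const s) - poly E (Const s) * poly Q (Const s)"
        by simp
      then have "eval4 (poly r (Const s)) b = eval4 a b * eval4 (poly F (Const s)) b
          - eval4 (poly E (Const s)) b * eval4 (poly Q (Const s)) b"
        by (simp add: eval4_simps)
      then show "eval4 (poly r (Const s)) b = 0"
        using z E(2) by (simp add: V_def F_def eval4_poly_sweep)
    qed
    then have "r = 0" using r min[of r] by force
    then have aF: "smult a F = E * Q" using aQ(2) by simp
    \<comment> \<open>The point found below must not be the zero vector. A base point off the line spanned by \<open>u\<close>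
        ensures this, and the linear form \<open>z\<close> vanishes on that line.\<close>
    obtain w w' :: 4 where w: "u $ w \<noteq> 0" "w' \<noteq> w"
    proof -
      have "u \<noteq> 0"
        using u eval4_scale[OF f(1), where s = 0 and a = u] \<open>d \<noteq> 0\<close> by (auto simp: zero_power)
      then obtain w where "u $ w \<noteq> 0" by (auto simp: vec_eq_iff)
      moreover have "w + 1 \<noteq> w" by simp
      ultimately show ?thesis using that by blast
    qed
    define z where "z = Const (u $ w) * Var w' - Const (u $ w') * Var w"
    have "eval4 z (axis w' 1) \<noteq> 0" using w by (simp add: z_def eval4_simps axis_def)
    then have "z \<noteq> 0" by (auto simp: eval4_simps)
    then have "a * z \<noteq> 0" using aQ(1) by simp
    then obtain b where b: "eval4 (a * z) b \<noteq> 0" using eval4_zero_imp_zero by blast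
    then have ab: "eval4 a b \<noteq> 0" and zb: "eval4 z b \<noteq> 0" by (auto simp: eval4_simps)
    let ?m = "map_poly (\<lambda>r. eval4 r b)"
    have eq: "smult (eval4 a b) (?m F) = ?m E * ?m Q"
    proof -
      have "?m ([:a:] * F) = ?m [:a:] * ?m F"
        by (rule comm_ring_map.map_poly_mult[OF comm_ring_map_eval4])
      then have "smult (eval4 a b) (?m F) = ?m (smult a F)"
        by (simp add: map_poly_pCons eval4_simps)
      then show ?thesis
        by (simp add: aF comm_ring_map.map_poly_mult[OF comm_ring_map_eval4])
    qed
    have nz: "?m F \<noteq> 0" using degF[of b] \<open>d \<noteq> 0\<close> by auto
    then have "?m E * ?m Q \<noteq> 0" using eq ab by (metis smult_eq_0_iff)
    then have "degree (?m E) + degree (?m Q) = d"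
      using arg_cong[OF eq, of degree] ab degF[of b] by (simp add: degree_mult_eq)
    then have "degree (?m Q) > 0"
      using map_poly_degree_leq[of "\<lambda>r. eval4 r b" E] degE by linarith
    then obtain s where s: "poly (?m Q) s = 0"
      using alg_closed_imp_poly_has_root by blast
    define p where "p = b + s *s u"
    have "poly (smult (eval4 a b) (?m F)) s = 0" by (simp add: eq s)
    then have fp: "eval4 f (b + s *s u) = 0" using ab by (simp add: polyF)
    then have E0: "eval4 (poly E (Const s)) b = 0" using E(2) by (simp add: V_def)
    have Q0: "eval4 (poly Q (Const s)) b = 0"
      using s comm_ring_map.poly_map_poly[OF comm_ring_map_eval4, of b Q "Const s"]
      by (simp add: eval4_Const)
    have "singular_at f p"
    proof (rule singular_atI)
      have "eval4 z (p - s *s u) \<noteq> 0" using zb by (simp add: p_def)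
      then show "p \<noteq> 0" by (auto simp: z_def eval4_simps)
    next
      fix e
      show "coeff (line_poly f p e) 0 = 0" using fp by (simp add: p_def coeff_0_line_poly)
      have "poly (smult a F) (Const s) = poly (E * Q) (Const s)" by (simp only: aF)
      then have "a * poly F (Const s) = poly E (Const s) * poly Q (Const s)" by simp
      then have "line_poly a b e * line_poly f p e
          = line_poly (poly E (Const s)) b e * line_poly (poly Q (Const s)) b e"
        unfolding p_def line_poly_poly_sweep[symmetric] F_def[symmetric]
          comm_ring_map.map_mult[OF comm_ring_map_line_poly, symmetric] by simp
      then have "coeff (line_poly a b e * line_poly f p e) 1 = coeff
          (line_poly (poly E (Const s)) b e * line_poly (poly Q (Const s)) b e) 1" by simp
      then have "eval4 a b * coeff (line_poly f p e) 1 = 0"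
        using E0 Q0 fp by (simp add: coeff_mult coeff_0_line_poly p_def)
      then show "coeff (line_poly f p e) 1 = 0" using ab by simp
    qed
    then show False using ns by (simp add: nonsingular_form_def)
  qed
  then show ?thesis by (auto simp: g_def)
qed

section \<open>Linear changes of coordinates\<close>

definition linear_subst :: "'k::field ^ 4 ^ 4 \<Rightarrow> 'k poly4 \<Rightarrow> 'k poly4" where
  "linear_subst A f = subst4 Const (\<lambda>v. \<Sum>w\<in>UNIV. Const (A $ v $ w) * Var w) f"

lemma eval4_linear_subst: "eval4 (linear_subst A f) x = eval4 f (A *v x)"
proof -
  have "(\<chi> v. eval4 (\<Sum>w\<in>UNIV. Const (A $ v $ w) * Var w) x) = A *v x"
    by (simp add: vec_eq_iff matrix_vector_mult_def eval4_simps
        comm_ring_map.map_sum[OF comm_ring_map_eval4])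
  then show ?thesis by (simp add: linear_subst_def eval4_subst4_Const)
qed

lemma line_poly_linear_subst: "line_poly (linear_subst A f) a e = line_poly f (A *v a) (A *v e)"
proof -
  have C: "line_poly (Const c) a e = [:c:]" and V: "line_poly (Var v) a e = [:a $ v, e $ v:]" for c v
    by (simp_all add: line_poly_def subst4_Const subst4_Var comm_ring_map_const_poly)
  have S: "(\<Sum>w\<in>UNIV. line_poly (Const (A $ v $ w) * Var w) a e) = [:(A *v a) $ v, (A *v e) $ v:]" for v
    by (simp add: comm_ring_map.map_mult[OF comm_ring_map_line_poly] C V matrix_vector_mult_def sum_4)
  show ?thesis
    unfolding linear_subst_def comm_ring_map.map_subst4[OF comm_ring_map_line_poly]
      comm_ring_map.map_sum[OF comm_ring_map_line_poly] C S
    by (simp add: line_poly_def[of f])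
qed

lemma form_of_degree_linear_subst:
  assumes "form_of_degree d f"
  shows "form_of_degree d (linear_subst A f)"
  unfolding linear_subst_def subst4_def
proof (intro form_of_degree_sum form_of_degree_Const_mult)
  fix m assume m: "m \<in> Poly_Mapping.keys f"
  have "form_of_degree 1 (\<Sum>w\<in>UNIV. Const (A $ v $ w) * Var w)" for v
    by (intro form_of_degree_sum form_of_degree_Const_mult form_of_degree_Var)
  then have "form_of_degree (\<Sum>v\<in>UNIV. 1 * Poly_Mapping.lookup m v)
      (\<Prod>v\<in>UNIV. (\<Sum>w\<in>UNIV. Const (A $ v $ w) * Var w) ^ Poly_Mapping.lookup m v)"
    by (intro form_of_degree_prod form_of_degree_power)
  then show "form_of_degree d (subst_monom (\<lambda>v. \<Sum>w\<in>UNIV. Const (A $ v $ w) * Var w) m)"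
    using assms m by (simp add: subst_monom_def form_of_degree_def)
qed


section \<open>Projective transformations\<close>

lemma pclass_eq: "pclass A = {mat c ** A | c. c \<noteq> 0}"
  by (auto simp: pclass_def r_coset_def scalars4_def GL4_def)

lemma carrier_PGL4: "carrier PGL4 = {pclass A | A. invertible A}"
  by (auto simp: PGL4_def FactGroup_def RCOSETS_def pclass_def GL4_def)

lemma pclass_in_PGL4: "invertible A \<Longrightarrow> pclass A \<in> carrier PGL4"
  by (auto simp: carrier_PGL4)

lemma pclass_mult:
  assumes "invertible A" "invertible B"
  shows "pclass A \<otimes>\<^bsub>PGL4\<^esub> pclass B = pclass (A ** B)"
  using normal.rcos_sum[OF normal_scalars4, of A B] assms
  by (simp add: PGL4_def FactGroup_def pclass_def GL4_def)

lemma pclass_one: "\<one>\<^bsub>PGL4\<^esub> = pclass (mat 1)"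
proof -
  have "(mat 1 :: 'a ^ 4 ^ 4) \<in> carrier GL4"
    using group.is_monoid[OF group_GL4] monoid.one_closed[of "GL4 :: ('a ^ 4 ^ 4) monoid"]
    by (simp add: GL4_def)
  then show ?thesis
    using scalars4_def by (auto simp: pclass_eq PGL4_def FactGroup_def scalars4_def)
qed

lemma inv_pclass:
  assumes "A ** B = mat 1" "B ** A = mat 1"
  shows "inv\<^bsub>PGL4\<^esub> pclass A = pclass (B :: 'k::field ^ 4 ^ 4)"
proof -
  have "invertible A" "invertible B" using assms by (auto simp: invertible_def)
  then show ?thesis
    using assms by (intro group.inv_equality[OF group_PGL4])
      (simp_all add: pclass_mult pclass_one pclass_in_PGL4)
qed

lemma mat_vector_mult: "mat c *v (x :: 'k::field ^ 4) = c *s x"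
  by (simp add: vec_eq_iff matrix_vector_mult_def mat_def if_distrib if_distribR sum.delta cong: if_cong)

lemma pact_pclass_ppoint: "pact (pclass A) (ppoint a) = ppoint (A *v a)"
proof -
  have "(mat c ** A) *v (d *s a) = (c * d) *s (A *v a)" for c d
    by (simp add: matrix_vector_mul_assoc[symmetric] mat_vector_mult vector_scalar_commute)
  then have "pact (pclass A) (ppoint a) = {(c * d) *s (A *v a) | c d. c \<noteq> 0 \<and> d \<noteq> 0}"
    unfolding pact_def pclass_eq ppoint_def by (auto; metis)
  also have "\<dots> = ppoint (A *v a)"
    unfolding ppoint_def
  proof (intro equalityI subsetI)
    fix x assume "x \<in> {c *s (A *v a) | c. c \<noteq> 0}"
    then obtain c where "c \<noteq> 0" "x = (c * 1) *s (A *v a)" by auto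
    then show "x \<in> {(c * d) *s (A *v a) | c d. c \<noteq> 0 \<and> d \<noteq> 0}"
      using one_neq_zero by blast
  qed auto
  finally show ?thesis .
qed

lemma ppoint_in_zero_locus:
  assumes "form_of_degree d f"
  shows "ppoint a \<in> zero_locus f \<longleftrightarrow> a \<noteq> 0 \<and> eval4 f a = 0"
proof
  assume "ppoint a \<in> zero_locus f"
  then obtain b where b: "ppoint a = ppoint b" "b \<noteq> 0" "eval4 f b = 0"
    by (auto simp: zero_locus_def)
  have "1 *s a \<in> ppoint a" unfolding ppoint_def using one_neq_zero by blast
  then obtain c where "c \<noteq> 0" "a = c *s b"
    by (auto simp only: b(1)) (auto simp: ppoint_def)
  then show "a \<noteq> 0 \<and> eval4 f a = 0"
    using b(2,3) by (auto simp: eval4_scale[OF assms])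
qed (auto simp: zero_locus_def)

lemma zero_locus_linear_subst:
  assumes "A ** B = mat 1" "B ** A = mat 1"
  shows "zero_locus (linear_subst A f) = pact (pclass B) ` zero_locus f"
proof -
  have inv: "A *v (B *v x) = x" "B *v (A *v x) = x" for x
    using assms by (simp_all add: matrix_vector_mul_assoc)
  have nz: "A *v x \<noteq> 0" "B *v x \<noteq> 0" if "x \<noteq> 0" for x
    using that inv[of x] by (metis matrix_vector_mult_0_right)+
  show ?thesis
  proof (intro equalityI subsetI)
    fix p assume "p \<in> zero_locus (linear_subst A f)"
    then obtain a where a: "p = ppoint a" "a \<noteq> 0" "eval4 f (A *v a) = 0"
      by (auto simp: zero_locus_def eval4_linear_subst)
    then have "ppoint (A *v a) \<in> zero_locus f" using nz by (auto simp: zero_locus_def)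
    moreover have "p = pact (pclass B) (ppoint (A *v a))" by (simp add: pact_pclass_ppoint inv a)
    ultimately show "p \<in> pact (pclass B) ` zero_locus f" by blast
  next
    fix p assume "p \<in> pact (pclass B) ` zero_locus f"
    then obtain a where a: "p = ppoint (B *v a)" "a \<noteq> 0" "eval4 f a = 0"
      by (auto simp: zero_locus_def pact_pclass_ppoint)
    then have "eval4 (linear_subst A f) (B *v a) = 0" by (simp add: eval4_linear_subst inv)
    then show "p \<in> zero_locus (linear_subst A f)" using a nz by (auto simp: zero_locus_def)
  qed
qed

definition semi_invariant :: "'k::field poly4 \<Rightarrow> 'k ^ 4 ^ 4 \<Rightarrow> 'k \<Rightarrow> bool" where
  "semi_invariant g A c \<longleftrightarrow> (\<forall>x. eval4 g (A *v x) = c * eval4 g x)"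

text \<open>
  The conjugating transformation is absorbed into the coordinates. A generator \<open>R\<close> then maps the zero
  locus of the transformed form \<open>g\<close> to itself, so \<open>g(R x)\<close> vanishes on \<open>V(g)\<close> and is a multiple of
  \<open>g(x)\<close>. Nonsingularity is transported as the statement that no point is a double point of all lines
  through it.
\<close>

theorem invariant_surface_normal_form:
  fixes f :: "'k::{alg_closed_field, field_char_0} poly4"
  assumes f: "quartic_form f" "nonsingular_form f"
    and inv: "group_invariant (generate PGL4 (pclass ` S)) (zero_locus f)"
    and S: "\<And>R. R \<in> S \<Longrightarrow> invertible R"
  obtains g where "quartic_form g" "proj_equivalent (zero_locus f) (zero_locus g)"
    "\<forall>R\<in>S. \<exists>c. semi_invariant g R c"
    "\<forall>a. a \<noteq> 0 \<longrightarrow> (\<exists>e. coeff (line_poly g a e) 0 \<noteq> 0 \<or> coeff (line_poly g a e) 1 \<noteq> 0)"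
proof -
  have f4: "f \<noteq> 0" "form_of_degree 4 f" using f(1) by (auto simp: quartic_form_iff)
  obtain H where H: "H \<subseteq> Paut (zero_locus f)"
    "conjugate_subgroups (generate PGL4 (pclass ` S)) H"
    using inv by (auto simp: group_invariant_def)
  obtain P where P: "P \<in> carrier PGL4" "H = (\<lambda>C. P \<otimes>\<^bsub>PGL4\<^esub> C \<otimes>\<^bsub>PGL4\<^esub> inv\<^bsub>PGL4\<^esub> P) `
      generate PGL4 (pclass ` S)"
    using H(2) unfolding conjugate_subgroups_def by blast
  obtain T where T: "invertible T" "P = pclass T" using P(1) by (auto simp: carrier_PGL4)
  obtain T' where T': "T ** T' = mat 1" "T' ** T = mat 1" using T(1) by (auto simp: invertible_def)
  then have T'i: "invertible T'" by (auto simp: invertible_def)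
  have TT': "T *v (T' *v x) = x" "T' *v (T *v x) = x" for x
    using T' by (simp_all add: matrix_vector_mul_assoc)
  have nz: "T *v x \<noteq> 0" "T' *v x \<noteq> 0" if "x \<noteq> 0" for x
    using that TT'[of x] by (metis matrix_vector_mult_0_right)+
  define g where "g = linear_subst T f"
  have g: "eval4 g x = eval4 f (T *v x)" for x by (simp add: g_def eval4_linear_subst)
  have "g \<noteq> 0"
  proof
    assume "g = 0"
    then have "eval4 f x = 0" for x using g[of "T' *v x"] TT' by (simp add: eval4_simps)
    then show False using eval4_zero_imp_zero[of f] f4(1) by blast
  qed
  then have qg: "quartic_form g"
    using form_of_degree_linear_subst[OF f4(2)] by (simp add: quartic_form_iff g_def)
  have pe: "proj_equivalent (zero_locus f) (zero_locus g)"
    unfolding proj_equivalent_def g_def zero_locus_linear_subst[OF T']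
    using pclass_in_PGL4[OF T'i] by blast
  have semi: "\<exists>c. semi_invariant g R c" if R: "R \<in> S" for R
  proof -
    define M where "M = T ** R ** T'"
    have MT: "M *v (T *v x) = T *v (R *v x)" for x
      by (simp add: M_def matrix_vector_mul_assoc[symmetric] TT')
    have "P \<otimes>\<^bsub>PGL4\<^esub> pclass R \<otimes>\<^bsub>PGL4\<^esub> inv\<^bsub>PGL4\<^esub> P = pclass M"
      unfolding T(2) inv_pclass[OF T'] M_def using T(1) T'i S[OF R]
      by (simp add: pclass_mult invertible_mult)
    moreover have "pclass R \<in> generate PGL4 (pclass ` S)" using R by (auto intro: generate.incl)
    ultimately have "pclass M \<in> H" unfolding P(2) by (metis (no_types, lifting) imageI)
    then have pM: "pact (pclass M) ` zero_locus f = zero_locus f"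
      using H(1) by (auto simp: Paut_def)
    have "eval4 (linear_subst M f) a = 0" if a: "eval4 f a = 0" for a
    proof (cases "a = 0")
      case True
      then show ?thesis using a by (simp add: eval4_linear_subst)
    next
      case False
      then have "ppoint a \<in> zero_locus f" using a by (auto simp: zero_locus_def)
      then have "ppoint (M *v a) \<in> zero_locus f"
        using pM by (metis imageI pact_pclass_ppoint)
      then show ?thesis by (simp add: eval4_linear_subst ppoint_in_zero_locus[OF f4(2)])
    qed
    then obtain c where c: "linear_subst M f = Const c * f"
      using form_vanishing_on_nonsingular_form[OF f4(2,1) f(2) form_of_degree_linear_subst[OF f4(2)]]
      by blast
    have "eval4 f (M *v x) = c * eval4 f x" for x
      using arg_cong[OF c, of "\<lambda>h. eval4 h x"] by (simp add: eval4_linear_subst eval4_simps)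
    then show ?thesis
      by (auto simp: semi_invariant_def g MT[symmetric])
  qed
  have sm: "\<exists>e. coeff (line_poly g a e) 0 \<noteq> 0 \<or> coeff (line_poly g a e) 1 \<noteq> 0" if a: "a \<noteq> 0" for a
  proof (rule ccontr)
    assume "\<not> ?thesis"
    then have "coeff (line_poly g a (T' *v e)) 0 = 0 \<and> coeff (line_poly g a (T' *v e)) 1 = 0" for e
      by blast
    then have "singular_at f (T *v a)"
      by (intro singular_atI nz a) (simp_all add: g_def line_poly_linear_subst TT')
    then show False using f(2) by (simp add: nonsingular_form_def)
  qed
  show thesis using that[OF qg pe] semi sm by blast
qed


section \<open>Multipliers of semi-invariants\<close>

lemma semi_invariant_mult:
  "semi_invariant g A c \<Longrightarrow> semi_invariant g B d \<Longrightarrow> semi_invariant g (A ** B) (c * d)"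
  by (simp add: semi_invariant_def matrix_vector_mul_assoc[symmetric])

lemma semi_invariant_scalar:
  assumes "quartic_form g"
  shows "semi_invariant g (mat s) (s ^ 4)"
  using assms by (simp add: semi_invariant_def mat_vector_mult eval4_scale quartic_form_iff)

text \<open>
  Uniqueness makes the multiplier a homomorphism, so that relations between matrices become
  equations between multipliers.
\<close>

lemma semi_invariant_unique:
  fixes g :: "'k::field_char_0 poly4"
  assumes "quartic_form g" "semi_invariant g A c" "semi_invariant g A d"
  shows "c = d"
proof -
  have "g \<noteq> 0" using assms(1) by (simp add: quartic_form_iff)
  then obtain x where x: "eval4 g x \<noteq> 0" using eval4_zero_imp_zero[of g] by blast
  have "c * eval4 g x = d * eval4 g x"
    using assms(2,3) by (metis semi_invariant_def)
  then show ?thesis using x by simp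
qed

text \<open>
  A diagonal matrix acts on each monomial by a scalar, so a semi-invariant can contain only
  monomials on which this scalar is the multiplier.
\<close>

lemma lookup_semi_invariant_diagonal:
  fixes g :: "'k::field_char_0 poly4"
  assumes "\<And>x. eval4 g (\<chi> v. t v * x $ v) = c * eval4 g x"
  shows "Poly_Mapping.lookup g m * subst_monom t m = c * Poly_Mapping.lookup g m"
proof -
  define h where "h = (\<Sum>n\<in>Poly_Mapping.keys g.
    Poly_Mapping.single n (Poly_Mapping.lookup g n * subst_monom t n))"
  have h: "Poly_Mapping.lookup h n = Poly_Mapping.lookup g n * subst_monom t n" for n
  proof -
    have "(\<Sum>k\<in>Poly_Mapping.keys g. Poly_Mapping.lookup g k * subst_monom t k when k = n)
        = (\<Sum>k\<in>Poly_Mapping.keys g. if k = n then Poly_Mapping.lookup g k * subst_monom t k else 0)"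
      by (intro sum.cong) (auto simp: when_def)
    then show ?thesis by (simp add: h_def lookup_sum lookup_single in_keys_iff)
  qed
  have "eval4 h x = eval4 (Const c * g) x" for x
  proof -
    have "eval4 h x = (\<Sum>n\<in>Poly_Mapping.keys g.
        Poly_Mapping.lookup g n * subst_monom t n * subst_monom (($) x) n)"
      unfolding h_def comm_ring_map.map_sum[OF comm_ring_map_eval4]
      by (simp add: eval4_eq_subst4 subst4_single comm_ring_map_id)
    also have "\<dots> = eval4 g (\<chi> v. t v * x $ v)"
      by (simp add: eval4_eq_subst4 subst4_def subst_monom_def power_mult_distrib prod.distrib mult.assoc)
    finally show ?thesis using assms by (simp add: eval4_simps)
  qed
  then have "h = Const c * g" by (rule poly4_eqI)
  moreover have "Poly_Mapping.lookup (Const c * g) m = c * Poly_Mapping.lookup g m"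
  proof (induction g rule: poly4_induct)
    case (single n d)
    show ?case by (simp add: Const_def mult_single lookup_single when_def)
  qed (simp add: distrib_left lookup_add)
  ultimately show ?thesis by (metis h)
qed

section \<open>The generators and their relations\<close>

definition vec4 :: "'k::field \<Rightarrow> 'k \<Rightarrow> 'k \<Rightarrow> 'k \<Rightarrow> 'k ^ 4" where
  "vec4 x y z t = vector [x, y, z, t]"

lemma vector_4:
  "(vector [x, y, z, t] :: ('a::zero) ^ 4) $ 1 = x" "(vector [x, y, z, t] :: 'a ^ 4) $ 2 = y"
  "(vector [x, y, z, t] :: 'a ^ 4) $ 3 = z" "(vector [x, y, z, t] :: 'a ^ 4) $ 4 = t"
  by (simp_all add: vector_def)

lemma vec4_nth [simp]:
  "vec4 x y z t $ 1 = x" "vec4 x y z t $ 2 = y" "vec4 x y z t $ 3 = z" "vec4 x y z t $ 4 = t"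
  by (simp_all add: vec4_def vector_4)

lemma vec4_eta: "x = vec4 (x $ 1) (x $ 2) (x $ 3) (x $ 4)"
  by (simp add: vec_eq_iff forall_4)

lemma mat4_mult_vec4:
  "mat4 [[a11, a12, a13, a14], [a21, a22, a23, a24], [a31, a32, a33, a34], [a41, a42, a43, a44]]
     *v vec4 x y z t
   = vec4 (a11 * x + a12 * y + a13 * z + a14 * t) (a21 * x + a22 * y + a23 * z + a24 * t)
       (a31 * x + a32 * y + a33 * z + a34 * t) (a41 * x + a42 * y + a43 * z + a44 * t)"
  by (simp add: vec_eq_iff forall_4 matrix_vector_mult_def sum_4 mat4_def vector_4)

lemma mat4_mult_mat4:
  "mat4 [[a11, a12, a13, a14], [a21, a22, a23, a24], [a31, a32, a33, a34], [a41, a42, a43, a44]]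
   ** mat4 [[b11, b12, b13, b14], [b21, b22, b23, b24], [b31, b32, b33, b34], [b41, b42, b43, b44]]
   = mat4
     [[a11*b11 + a12*b21 + a13*b31 + a14*b41, a11*b12 + a12*b22 + a13*b32 + a14*b42,
       a11*b13 + a12*b23 + a13*b33 + a14*b43, a11*b14 + a12*b24 + a13*b34 + a14*b44],
      [a21*b11 + a22*b21 + a23*b31 + a24*b41, a21*b12 + a22*b22 + a23*b32 + a24*b42,
       a21*b13 + a22*b23 + a23*b33 + a24*b43, a21*b14 + a22*b24 + a23*b34 + a24*b44],
      [a31*b11 + a32*b21 + a33*b31 + a34*b41, a31*b12 + a32*b22 + a33*b32 + a34*b42,
       a31*b13 + a32*b23 + a33*b33 + a34*b43, a31*b14 + a32*b24 + a33*b34 + a34*b44],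
      [a41*b11 + a42*b21 + a43*b31 + a44*b41, a41*b12 + a42*b22 + a43*b32 + a44*b42,
       a41*b13 + a42*b23 + a43*b33 + a44*b43, a41*b14 + a42*b24 + a43*b34 + a44*b44]]"
  by (simp add: vec_eq_iff forall_4 matrix_matrix_mult_def sum_4 mat4_def vector_4)

lemma mat_eq_mat4: "mat c = mat4 [[c, 0, 0, 0], [0, c, 0, 0], [0, 0, c, 0], [0, 0, 0, c]]"
  by (simp add: vec_eq_iff forall_4 mat_def mat4_def vector_4)

lemma mat4_cong:
  assumes "a11 = b11" "a12 = b12" "a13 = b13" "a14 = b14" "a21 = b21" "a22 = b22" "a23 = b23"
    "a24 = b24" "a31 = b31" "a32 = b32" "a33 = b33" "a34 = b34" "a41 = b41" "a42 = b42"
    "a43 = b43" "a44 = b44"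
  shows "mat4 [[a11, a12, a13, a14], [a21, a22, a23, a24], [a31, a32, a33, a34], [a41, a42, a43, a44]]
   = mat4 [[b11, b12, b13, b14], [b21, b22, b23, b24], [b31, b32, b33, b34], [b41, b42, b43, b44]]"
  using assms by simp

lemma invertible_if_square:
  fixes A :: "'k::field ^ 4 ^ 4"
  assumes "A ** A = mat c" "c \<noteq> 0"
  shows "invertible A"
proof -
  have "A ** (mat (inverse c) ** A) = mat 1" "(mat (inverse c) ** A) ** A = mat 1"
    using assms by (metis mat_mult_commute mat_mult_mat matrix_mul_assoc right_inverse left_inverse)+
  then show ?thesis by (auto simp: invertible_def)
qed

lemma invertible_if_cube:
  fixes A :: "'k::field ^ 4 ^ 4"
  assumes "A ** A ** A = mat 1"
  shows "invertible A"
  using assms by (auto simp: invertible_def matrix_mul_assoc intro!: exI[of _ "A ** A"])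

lemma omega_quadratic:
  fixes i s3 :: "'k::field_char_0"
  assumes "i^2 = -1" "s3^2 = 3"
  shows "(omega i s3)^2 + omega i s3 + 1 = 0"
proof -
  have w: "2 * omega i s3 = -1 + i * s3" by (simp add: omega_def)
  have "(2 * omega i s3 + 1)^2 = -3" unfolding w by (simp add: power_mult_distrib assms)
  then have "4 * ((omega i s3)^2 + omega i s3 + 1) = 0" by algebra
  then show ?thesis by (simp only: mult_eq_0_iff) simp
qed

lemma omega_cube:
  fixes i s3 :: "'k::field_char_0"
  shows "i^2 = -1 \<Longrightarrow> s3^2 = 3 \<Longrightarrow> (omega i s3)^3 = 1"
  using omega_quadratic[of i s3] by algebra

lemma omega_neq_1:
  fixes i s3 :: "'k::field_char_0"
  shows "i^2 = -1 \<Longrightarrow> s3^2 = 3 \<Longrightarrow> omega i s3 \<noteq> 1"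
  using omega_quadratic[of i s3] by auto

text \<open>
  The fixed square roots. Products of them are reduced by rewriting with \<open>root_mult\<close>; this decides
  the identities between entries of the generating matrices.
\<close>

locale root_choice =
  fixes i s2 s3 s5 :: "'k::{alg_closed_field, field_char_0}"
  assumes i2: "i^2 = -1" and s22: "s2^2 = 2" and s32: "s3^2 = 3" and s52: "s5^2 = 5"
begin

lemma root_mult: "i * i = -1" "i * (i * x) = - x" "s2 * s2 = 2" "s2 * (s2 * x) = 2 * x"
  "s3 * s3 = 3" "s3 * (s3 * x) = 3 * x" "s5 * s5 = 5" "s5 * (s5 * x) = 5 * x"
  using i2 s22 s32 s52 by (simp_all add: power2_eq_square flip: mult.assoc)

abbreviation "w \<equiv> omega i s3"

lemmas w3 = omega_cube[OF i2 s32] and w_neq_1 = omega_neq_1[OF i2 s32]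

lemma w_half: "w = (-1 + i * s3) / 2"
  by (simp add: omega_def)

lemma roots_nonzero: "s2 \<noteq> 0" "s3 \<noteq> 0" "s5 \<noteq> 0"
  using s22 s32 s52 by auto

lemma R22_eq: "R22 s2 s3 = mat4 [[s3/3, 0, 0, s2 * s3/3], [0, -s3/3, s2 * s3/3, 0],
    [0, s2 * s3/3, s3/3, 0], [s2 * s3/3, 0, 0, -s3/3]]"
proof -
  have "1 / s3 = s3 / 3" using roots_nonzero by (simp add: field_simps root_mult)
  then show ?thesis
    unfolding R22_def mat_eq_mat4 mat4_mult_mat4 by (intro mat4_cong) (simp_all del: times_divide_eq_left times_divide_eq_right divide_eq_eq)
qed

lemma R32_eq: "R32 s2 s3 = mat4 [[s3/3, 0, 0, s2 * s3/3], [0, s3/3, s2 * s3/3, 0],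
    [0, s2 * s3/3, -s3/3, 0], [s2 * s3/3, 0, 0, -s3/3]]"
proof -
  have "1 / s3 = s3 / 3" using roots_nonzero by (simp add: field_simps root_mult)
  then show ?thesis
    unfolding R32_def mat_eq_mat4 mat4_mult_mat4 by (intro mat4_cong) (simp_all del: times_divide_eq_left times_divide_eq_right divide_eq_eq)
qed

lemma nu_mult: "nu_plus i s2 s3 s5 * nu_minus i s2 s3 s5 = 1"
proof -
  have "(s3 + i * s5) * (s3 - i * s5) = 8" by (simp add: algebra_simps root_mult)
  moreover have "(2 * s2) * (2 * s2) = 8" by (simp add: algebra_simps root_mult)
  ultimately show ?thesis by (simp add: nu_plus_def nu_minus_def)
qed

lemma R11_cube: "R11 i s3 ** R11 i s3 ** R11 i s3 = mat 1"
  unfolding R11_def Let_def mat_eq_mat4 mat4_mult_mat4 w_half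
  by (intro mat4_cong; simp add: field_simps power2_eq_square root_mult)

lemma R12_square: "R12 ** R12 = (mat 1 :: 'k ^ 4 ^ 4)"
  unfolding R12_def mat_eq_mat4 mat4_mult_mat4 by (intro mat4_cong; simp)

lemma R13_square: "R13 s3 s5 ** R13 s3 s5 = mat 1"
  unfolding R13_def Let_def mat_eq_mat4 mat4_mult_mat4
  by (intro mat4_cong; simp add: field_simps power2_eq_square root_mult)

lemma R14_square: "R14 ** R14 = (mat 1 :: 'k ^ 4 ^ 4)"
  unfolding R14_def mat_eq_mat4 mat4_mult_mat4 by (intro mat4_cong; simp)

lemma R11_R14: "R11 i s3 ** R14 ** R11 i s3 = R14"
  unfolding R11_def R14_def Let_def mat4_mult_mat4 w_half
  by (intro mat4_cong; simp add: field_simps power2_eq_square root_mult)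

lemma R11_R12: "R11 i s3 ** R12 ** R11 i s3 = R12 ** R11 i s3 ** R11 i s3 ** R12"
  unfolding R11_def R12_def Let_def mat4_mult_mat4 w_half
  by (intro mat4_cong; simp add: field_simps power2_eq_square root_mult)

lemma R12_R13: "R13 s3 s5 ** R12 ** R13 s3 s5 = R12 ** R13 s3 s5 ** R12"
  unfolding R13_def R12_def Let_def mat4_mult_mat4
  by (intro mat4_cong; simp add: field_simps power2_eq_square root_mult)

lemma R22_square: "R22 s2 s3 ** R22 s2 s3 = mat 1"
  unfolding R22_eq mat_eq_mat4 mat4_mult_mat4
  by (intro mat4_cong; simp add: field_simps power2_eq_square root_mult)

lemma R23_square: "R23 s3 ** R23 s3 = mat 1"
  unfolding R23_def mat_eq_mat4 mat4_mult_mat4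
  by (intro mat4_cong; simp add: field_simps power2_eq_square root_mult)

lemma R24_square: "R24 ** R24 = (mat (-1) :: 'k ^ 4 ^ 4)"
  unfolding R24_def mat_eq_mat4 mat4_mult_mat4 by (intro mat4_cong; simp)

lemma R21_R24: "R21 i s3 ** R24 ** R21 i s3 = R24"
  unfolding R21_def R11_def R24_def Let_def mat4_mult_mat4 w_half
  by (intro mat4_cong; simp add: field_simps power2_eq_square root_mult)

lemma R21_R22: "R21 i s3 ** R22 s2 s3 ** R21 i s3
    = mat (- i) ** (R22 s2 s3 ** R21 i s3 ** R21 i s3 ** R22 s2 s3)"
  unfolding R21_def R11_def R22_eq Let_def mat_eq_mat4 mat4_mult_mat4 w_half
  by (intro mat4_cong; simp add: field_simps power2_eq_square root_mult)

lemma R22_R23: "R23 s3 ** R22 s2 s3 ** R23 s3 = R22 s2 s3 ** R23 s3 ** R22 s2 s3"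
  unfolding R23_def R22_eq mat4_mult_mat4
  by (intro mat4_cong; simp add: field_simps power2_eq_square root_mult)

lemma R31_cube: "R31 i s3 ** R31 i s3 ** R31 i s3 = mat 1"
  unfolding R31_def Let_def mat_eq_mat4 mat4_mult_mat4 w_half
  by (intro mat4_cong; simp add: field_simps power2_eq_square root_mult)

lemma R32_square: "R32 s2 s3 ** R32 s2 s3 = mat 1"
  unfolding R32_eq mat_eq_mat4 mat4_mult_mat4
  by (intro mat4_cong; simp add: field_simps power2_eq_square root_mult)

lemma R33_square: "R33 i s2 s3 s5 ** R33 i s2 s3 s5 = mat 1"
  unfolding R33_def Let_def mat_eq_mat4 mat4_mult_mat4 using nu_mult
  by (intro mat4_cong; simp add: mult.commute)

lemma R34_square: "R34 ** R34 = (mat 1 :: 'k ^ 4 ^ 4)"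
  unfolding R34_def mat_eq_mat4 mat4_mult_mat4 by (intro mat4_cong; simp)

lemma R31_R34: "R31 i s3 ** R34 ** R31 i s3 = R34"
  unfolding R31_def R34_def Let_def mat4_mult_mat4 w_half
  by (intro mat4_cong; simp add: field_simps power2_eq_square root_mult)

end

section \<open>The multipliers on the alternating group are trivial\<close>

text \<open>
  In \<open>\<^bold>S\<^sub>5\<close> the transposition inverts the 3-cycle. The multiplier of the 3-cycle therefore has order
  dividing 2 as well as 3. The scalar \<open>\<delta>\<close> allows for lifts of the transposition that are involutions only
  modulo scalars; scalars with fourth power 1 act trivially on quartics.
\<close>

lemma multiplier_order_3:
  fixes g :: "'k::field_char_0 poly4"
  assumes g: "quartic_form g"
    and a: "semi_invariant g A a" and d: "semi_invariant g D d"
    and rel: "A ** A ** A = mat 1" "A ** D ** A = D" "D ** D = mat \<delta>" "\<delta> ^ 4 = 1"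
  shows "a = 1" and "d = 1 \<or> d = -1"
proof -
  note unique = semi_invariant_unique[OF g]
  have "a * a * a = 1 ^ 4"
    using unique semi_invariant_mult[OF semi_invariant_mult[OF a a] a]
      semi_invariant_scalar[OF g, of 1] by (simp add: rel)
  moreover have dd: "d * d = \<delta> ^ 4"
    using unique semi_invariant_mult[OF d d] semi_invariant_scalar[OF g, of \<delta>] by (simp add: rel)
  moreover have "a * d * a = d"
    using unique semi_invariant_mult[OF semi_invariant_mult[OF a d] a] d by (simp add: rel)
  ultimately have aaa: "a * a * a = 1" and "a * a * d = 1 * d" and "d \<noteq> 0"
    using rel(4) by (auto simp: mult.assoc mult.commute[of d a])
  then have "a * a = 1" by (metis mult_right_cancel)
  then show "a = 1" using aaa by simp
  show "d = 1 \<or> d = -1"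
    using dd rel(4) by (simp add: square_eq_1_iff)
qed

text \<open>
  The products of the two pairs (3-cycle, first involution) and (first involution, second involution)
  have order 3, as elements of \<open>PGL\<^sub>4\<close>. Written without inverses, these relations force the
  multipliers of the involutions to be 1: the alternating group on five letters has no nontrivial
  characters.
\<close>

lemma multipliers_alternating:
  fixes g :: "'k::field_char_0 poly4"
  assumes g: "quartic_form g"
    and a: "semi_invariant g A 1" and b: "semi_invariant g B b" and c: "semi_invariant g C c"
    and rel: "B ** B = mat 1" "C ** C = mat 1" "A ** B ** A = mat \<mu> ** (B ** A ** A ** B)"
      "\<mu> ^ 4 = 1" "C ** B ** C = B ** C ** B"
  shows "b = 1" and "c = 1"
proof -
  note unique = semi_invariant_unique[OF g]
  have "b * b = 1 ^ 4" "c * c = 1 ^ 4"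
    using unique semi_invariant_mult[OF b b] semi_invariant_mult[OF c c]
      semi_invariant_scalar[OF g, of 1] by (simp_all add: rel)
  moreover have "1 * b * 1 = \<mu> ^ 4 * (b * 1 * 1 * b)"
    using unique semi_invariant_mult[OF semi_invariant_mult[OF a b] a]
      semi_invariant_mult[OF semi_invariant_scalar[OF g, of \<mu>]
        semi_invariant_mult[OF semi_invariant_mult[OF semi_invariant_mult[OF b a] a] b]]
    by (simp add: rel(3))
  moreover have "c * b * c = b * c * b"
    using unique semi_invariant_mult[OF semi_invariant_mult[OF c b] c]
      semi_invariant_mult[OF semi_invariant_mult[OF b c] b] by (simp add: rel(5))
  ultimately have bb: "b * b = 1" "b = b * b" and cc: "c * c = 1" "c * b * c = b * c * b"
    by (simp_all add: rel(4))
  show "b = 1" using bb by simp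
  then have "c * c = c" using cc(2) by simp
  then show "c = 1" using cc(1) by simp
qed


section \<open>Quartics invariant under the 3-cycle\<close>

definition exponents :: "nat \<times> nat \<times> nat \<times> nat \<Rightarrow> 4 \<Rightarrow>\<^sub>0 nat" where
  "exponents = (\<lambda>(p, q, r, s). Poly_Mapping.single 1 p + Poly_Mapping.single 2 q
     + Poly_Mapping.single 3 r + Poly_Mapping.single 4 s)"

lemma lookup_exponents:
  "Poly_Mapping.lookup (exponents (p, q, r, s)) 1 = p"
  "Poly_Mapping.lookup (exponents (p, q, r, s)) 2 = q"
  "Poly_Mapping.lookup (exponents (p, q, r, s)) 3 = r"
  "Poly_Mapping.lookup (exponents (p, q, r, s)) 4 = s"
  by (simp_all add: exponents_def lookup_add lookup_single when_def)

lemma inj_exponents: "inj_on exponents S"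
proof (rule inj_onI)
  fix e e' assume *: "exponents e = exponents e'"
  obtain p q r s p' q' r' s' where "e = (p, q, r, s)" "e' = (p', q', r', s')"
    by (cases e, cases e')
  then show "e = e'" using * by (metis lookup_exponents)
qed

lemma exponents_eta:
  "m = exponents (Poly_Mapping.lookup m 1, Poly_Mapping.lookup m 2, Poly_Mapping.lookup m 3,
     Poly_Mapping.lookup m 4)"
proof (rule poly_mapping_eqI)
  fix v
  have "\<forall>v. Poly_Mapping.lookup m v = Poly_Mapping.lookup (exponents (Poly_Mapping.lookup m 1,
      Poly_Mapping.lookup m 2, Poly_Mapping.lookup m 3, Poly_Mapping.lookup m 4)) v"
    by (simp add: forall_4 lookup_exponents)
  then show "Poly_Mapping.lookup m v = Poly_Mapping.lookup (exponents (Poly_Mapping.lookup m 1,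
      Poly_Mapping.lookup m 2, Poly_Mapping.lookup m 3, Poly_Mapping.lookup m 4)) v" by blast
qed

lemma prod_4: "prod f (UNIV::4 set) = f 1 * f 2 * f 3 * f 4"
  unfolding UNIV_4 by (simp add: ac_simps)

lemma power_cube_root_eq_1:
  fixes w :: "'k::field"
  assumes "w ^ 3 = 1" "w \<noteq> 1" "w ^ n = 1"
  shows "n mod 3 = 0"
proof -
  have "w ^ n = w ^ (3 * (n div 3) + n mod 3)" by simp
  also have "\<dots> = w ^ (n mod 3)" unfolding power_add power_mult assms(1) by simp
  finally have 1: "w ^ (n mod 3) = 1" using assms(3) by simp
  have "n mod 3 < 3" by simp
  then consider "n mod 3 = 0" | "n mod 3 = 1" | "n mod 3 = 2" by linarith
  then show ?thesis
  proof cases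
    case 3
    then have "w ^ 3 = w" using 1 by (simp add: power3_eq_cube power2_eq_square)
    then show ?thesis using assms by simp
  qed (use 1 assms in simp_all)
qed

context root_choice
begin

text \<open>
  The matrix multiplies \<open>x^p y^q z^r t^s\<close> by \<open>\<omega>^(r + 2 s)\<close>, so \<open>r + 2 s\<close> is divisible by 3 for the monomials of \<open>g\<close>.
\<close>

lemma monomials_R11_invariant:
  assumes "quartic_form g" "semi_invariant g (R11 i s3) 1" "m \<in> Poly_Mapping.keys g"
  shows "m \<in> exponents ` {(4,0,0,0), (3,1,0,0), (2,2,0,0), (1,3,0,0), (0,4,0,0), (2,0,1,1),
    (1,1,1,1), (0,2,1,1), (0,0,2,2), (1,0,3,0), (0,1,3,0), (1,0,0,3), (0,1,0,3)}"
proof -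
  let ?l = "Poly_Mapping.lookup m"
  define t :: "4 \<Rightarrow> 'k" where "t v = vec4 1 1 w (w^2) $ v" for v
  have "(\<chi> v. t v * x $ v) = R11 i s3 *v x" for x
    by (subst (2) vec4_eta) (simp only: R11_def Let_def mat4_mult_vec4 vec_eq_iff forall_4,
      simp add: t_def)
  then have "eval4 g (\<chi> v. t v * x $ v) = 1 * eval4 g x" for x
    using assms(2) by (simp add: semi_invariant_def)
  then have "Poly_Mapping.lookup g m * subst_monom t m = 1 * Poly_Mapping.lookup g m"
    by (rule lookup_semi_invariant_diagonal)
  then have "subst_monom t m = 1" using assms(3) by (simp add: in_keys_iff)
  then have "w ^ (?l 3 + 2 * ?l 4) = 1"
    by (simp add: subst_monom_def prod_4 t_def power_add power_mult)
  then have mod: "(?l 3 + 2 * ?l 4) mod 3 = 0"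
    by (rule power_cube_root_eq_1[OF w3 w_neq_1])
  have sum: "?l 1 + ?l 2 + ?l 3 + ?l 4 = 4"
    using assms(1,3) by (simp add: quartic_form_def sum_4)
  have "(p, q, r, s) \<in> {(4,0,0,0), (3,1,0,0), (2,2,0,0), (1,3,0,0), (0,4,0,0), (2,0,1,1),
      (1,1,1,1), (0,2,1,1), (0,0,2,2), (1,0,3,0), (0,1,3,0), (1,0,0,3), (0,1,0,3)}"
    if "p + q + r + s = 4" "(r + 2 * s) mod 3 = 0" for p q r s :: nat
  proof -
    have "p \<in> {0,1,2,3,4}" "q \<in> {0,1,2,3,4}" "r \<in> {0,1,2,3,4}" using that(1) by auto
    moreover have "s = 4 - p - q - r" using that(1) by simp
    ultimately show ?thesis using that by (elim insertE emptyE; simp)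
  qed
  from imageI[OF this[OF sum mod], of exponents] show ?thesis
    by (simp only: exponents_eta[of m, symmetric])
qed

lemma normal_form_R11:
  assumes "quartic_form g" "semi_invariant g (R11 i s3) 1"
  obtains a40 a31 a22 a13 a04 b20 b11 b02 c p q p' q'
  where "\<And>x y z t. eval4 g (vec4 x y z t) = a40 * x^4 + a31 * x^3 * y + a22 * x^2 * y^2
    + a13 * x * y^3 + a04 * y^4 + (b20 * x^2 + b11 * x * y + b02 * y^2) * z * t + c * z^2 * t^2
    + z^3 * (p * x + q * y) + t^3 * (p' * x + q' * y)"
proof -
  let ?M = "{(4,0,0,0), (3,1,0,0), (2,2,0,0), (1,3,0,0), (0,4,0,0), (2,0,1,1),
    (1,1,1,1), (0,2,1,1), (0,0,2,2), (1,0,3,0), (0,1,3,0), (1,0,0,3), (0,1,0,3)}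
    :: (nat \<times> nat \<times> nat \<times> nat) set"
  define L where "L e = Poly_Mapping.lookup g (exponents e)" for e
  have "eval4 g v = (\<Sum>e\<in>?M. L e * subst_monom (($) v) (exponents e))" for v
  proof -
    have "eval4 g v = (\<Sum>m\<in>exponents ` ?M. Poly_Mapping.lookup g m * subst_monom (($) v) m)"
      unfolding eval4_eq_subst4
      by (rule subst4_superset[OF _ _ comm_ring_map_id]) (use monomials_R11_invariant[OF assms] in auto)
    then show ?thesis by (simp only: sum.reindex[OF inj_exponents] o_def L_def)
  qed
  then have "eval4 g (vec4 x y z t) = L (4,0,0,0) * x^4 + L (3,1,0,0) * x^3 * y
    + L (2,2,0,0) * x^2 * y^2 + L (1,3,0,0) * x * y^3 + L (0,4,0,0) * y^4
    + (L (2,0,1,1) * x^2 + L (1,1,1,1) * x * y + L (0,2,1,1) * y^2) * z * t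
    + L (0,0,2,2) * z^2 * t^2 + z^3 * (L (1,0,3,0) * x + L (0,1,3,0) * y)
    + t^3 * (L (1,0,0,3) * x + L (0,1,0,3) * y)" for x y z t
    by (simp add: subst_monom_def prod_4 lookup_exponents algebra_simps)
  then show thesis by (rule that)
qed


section \<open>Quartics invariant under the third group\<close>

text \<open>
  The matrix multiplies a monomial of degree \<open>b\<close> in \<open>z, t\<close> by \<open>\<omega>^(4 + b)\<close>. An invariant quartic is therefore
  quadratic in \<open>x, y\<close> and quadratic in \<open>z, t\<close>, and it is singular along the line \<open>x = y = 0\<close>.
\<close>

lemma R31_invariant_double_line:
  assumes g: "quartic_form g" and inv: "semi_invariant g (R31 i s3) 1"
  shows "coeff (line_poly g (vec4 0 0 1 0) e) 0 = 0" "coeff (line_poly g (vec4 0 0 1 0) e) 1 = 0"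
proof -
  define t :: "4 \<Rightarrow> 'k" where "t v = vec4 w w (w^2) (w^2) $ v" for v
  have "(\<chi> v. t v * x $ v) = R31 i s3 *v x" for x
    by (subst (2) vec4_eta) (simp only: R31_def Let_def mat4_mult_vec4 vec_eq_iff forall_4,
      simp add: t_def)
  then have tg: "eval4 g (\<chi> v. t v * x $ v) = 1 * eval4 g x" for x
    using inv by (simp add: semi_invariant_def)
  have dv: "[:0, 1:]^2 dvd subst_monom (\<lambda>v. [:vec4 0 0 1 0 $ v, e $ v:]) m"
    if m: "m \<in> Poly_Mapping.keys g" for m
  proof -
    let ?l = "Poly_Mapping.lookup m"
    have "subst_monom t m = 1"
      using lookup_semi_invariant_diagonal[of g t, OF tg, of m] m by (simp add: in_keys_iff)
    then have "w ^ (?l 1 + ?l 2 + 2 * ?l 3 + 2 * ?l 4) = 1"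
      by (simp add: subst_monom_def prod_4 t_def power_add power_mult)
    then have "(?l 1 + ?l 2 + 2 * ?l 3 + 2 * ?l 4) mod 3 = 0"
      by (rule power_cube_root_eq_1[OF w3 w_neq_1])
    moreover have sum: "?l 1 + ?l 2 + ?l 3 + ?l 4 = 4"
      using g m by (simp add: quartic_form_def sum_4)
    ultimately have "?l 1 + ?l 2 = 2" by presburger
    have *: "[:0, 1:] dvd [:0, c:]" for c :: 'k
      by (rule dvdI[of _ _ "[:c:]"]) simp
    have "[:0, 1:] ^ (?l 1 + ?l 2) dvd [:0, e $ 1:] ^ ?l 1 * [:0, e $ 2:] ^ ?l 2"
      unfolding power_add by (intro mult_dvd_mono dvd_power_same *)
    then have "[:0, 1:]^2 dvd ([:0, e $ 1:] ^ ?l 1 * [:0, e $ 2:] ^ ?l 2)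
        * ([:1, e $ 3:] ^ ?l 3 * [:0, e $ 4:] ^ ?l 4)"
      by (simp only: \<open>?l 1 + ?l 2 = 2\<close> dvd_mult2)
    then show ?thesis by (simp add: subst_monom_def prod_4 mult.assoc)
  qed
  have "[:0, 1:]^2 dvd line_poly g (vec4 0 0 1 0) e"
    unfolding line_poly_def subst4_def by (intro dvd_sum dvd_mult dv)
  then obtain r where "line_poly g (vec4 0 0 1 0) e = [:0, 1:]^2 * r" by (elim dvdE)
  then show "coeff (line_poly g (vec4 0 0 1 0) e) 0 = 0" "coeff (line_poly g (vec4 0 0 1 0) e) 1 = 0"
    by (simp_all add: power2_eq_square)
qed

end

context root_choice
begin

section \<open>The generators evaluated at scaled points\<close>

text \<open>
  The points are scaled by the denominators of the matrices. The resulting functional equations have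
  no fractions, and on integral points they become linear equations for the coefficients.
\<close>

lemma invariant_R12_point:
  fixes g :: "'k poly4" and x y z t :: 'k
  assumes "semi_invariant g R12 1"
  shows "eval4 g (vec4 x (3 * y) (3 * z) (3 * t))
    = eval4 g (vec4 x (2 * z + 2 * t - y) (2 * y - z + 2 * t) (2 * y + 2 * z - t))"
proof -
  have "R12 *v vec4 x (3 * y) (3 * z) (3 * t)
      = vec4 x (2 * z + 2 * t - y) (2 * y - z + 2 * t) (2 * y + 2 * z - t)"
    unfolding R12_def mat4_mult_vec4 by (simp add: algebra_simps)
  then show ?thesis using assms by (metis semi_invariant_def mult_1)
qed

lemma invariant_R13_point:
  fixes g :: "'k poly4" and x y z t :: 'k
  assumes "semi_invariant g (R13 s3 s5) 1"
  shows "eval4 g (vec4 (4 * x) (4 * y) (4 * z) (4 * t))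
    = eval4 g (vec4 (s3 * s5 * y - x) (s3 * s5 * x + y) (4 * t) (4 * z))"
proof -
  have "R13 s3 s5 *v vec4 (4 * x) (4 * y) (4 * z) (4 * t)
      = vec4 (s3 * s5 * y - x) (s3 * s5 * x + y) (4 * t) (4 * z)"
    unfolding R13_def Let_def mat4_mult_vec4 by (simp add: algebra_simps)
  then show ?thesis using assms by (metis semi_invariant_def mult_1)
qed

lemma semi_invariant_R14_point:
  fixes g :: "'k poly4" and x y z t :: 'k
  assumes "semi_invariant g R14 d"
  shows "d * eval4 g (vec4 x y z t)
    = eval4 g (vec4 x y t z)"
proof -
  have "R14 *v vec4 x y z t = vec4 x y t z"
    unfolding R14_def mat4_mult_vec4 by simp
  then show ?thesis using assms by (metis semi_invariant_def)
qed

text \<open>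
  The factor 9 is \<open>(\<surd>3)^4\<close>, from the scalar in front of the matrix.
\<close>

lemma invariant_R22_point:
  fixes g :: "'k poly4" and x y z t :: 'k
  assumes "quartic_form g" "semi_invariant g (R22 s2 s3) 1"
  shows "9 * eval4 g (vec4 x y z t)
    = eval4 g (vec4 (x + s2 * t) (s2 * z - y) (s2 * y + z) (s2 * x - t))"
proof -
  have "R22 s2 s3 *v vec4 (s3 * x) (s3 * y) (s3 * z) (s3 * t)
      = vec4 (x + s2 * t) (s2 * z - y) (s2 * y + z) (s2 * x - t)"
    unfolding R22_eq mat4_mult_vec4 by (simp add: algebra_simps root_mult)
  moreover have "vec4 (s3 * x) (s3 * y) (s3 * z) (s3 * t) = s3 *s vec4 x y z t"
    by (simp add: vec_eq_iff forall_4)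
  moreover have "s3 ^ 4 = 9" by (simp add: power4_eq_xxxx root_mult)
  ultimately show ?thesis
    using assms by (metis semi_invariant_def mult_1 eval4_scale quartic_form_iff)
qed

lemma invariant_R23_point:
  fixes g :: "'k poly4" and x y z t :: 'k
  assumes "semi_invariant g (R23 s3) 1"
  shows "eval4 g (vec4 (2 * x) (2 * y) (2 * z) (2 * t))
    = eval4 g (vec4 (s3 * x + y) (x - s3 * y) (2 * t) (2 * z))"
proof -
  have "R23 s3 *v vec4 (2 * x) (2 * y) (2 * z) (2 * t) = vec4 (s3 * x + y) (x - s3 * y) (2 * t) (2 * z)"
    unfolding R23_def mat4_mult_vec4 by (simp add: algebra_simps)
  then show ?thesis using assms by (metis semi_invariant_def mult_1)
qed

lemma semi_invariant_R24_point:
  fixes g :: "'k poly4" and x y z t :: 'k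
  assumes "semi_invariant g R24 d"
  shows "d * eval4 g (vec4 x y z t)
    = eval4 g (vec4 y (- x) t (- z))"
proof -
  have "R24 *v vec4 x y z t = vec4 y (- x) t (- z)"
    unfolding R24_def mat4_mult_vec4 by simp
  then show ?thesis using assms by (metis semi_invariant_def)
qed

section \<open>Quartics invariant under the first group\<close>

text \<open>
  Antisymmetry under the exchange of \<open>z\<close> and \<open>t\<close> reduces the span of the 13 monomials to the products
  of \<open>z^3 - t^3\<close> with linear forms in \<open>x, y\<close>, and no nonzero product is invariant under \<open>R12\<close>.
\<close>

lemma odd_R14_vanishes:
  assumes g: "quartic_form g" and inv: "semi_invariant g (R11 i s3) 1" "semi_invariant g R12 1"
    "semi_invariant g R14 (-1)"
  shows False
proof -
  obtain a40 a31 a22 a13 a04 b20 b11 b02 c p q p' q' where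
    nf: "\<And>x y z t. eval4 g (vec4 x y z t) = a40 * x^4 + a31 * x^3 * y + a22 * x^2 * y^2
      + a13 * x * y^3 + a04 * y^4 + (b20 * x^2 + b11 * x * y + b02 * y^2) * z * t + c * z^2 * t^2
      + z^3 * (p * x + q * y) + t^3 * (p' * x + q' * y)"
    using normal_form_R11[OF g inv(1)] by blast
  define A where "A x y = a40 * x^4 + a31 * x^3 * y + a22 * x^2 * y^2 + a13 * x * y^3 + a04 * y^4" for x y
  define B where "B x y = b20 * x^2 + b11 * x * y + b02 * y^2" for x y
  have nfAB: "eval4 g (vec4 x y z t) = A x y + B x y * z * t + c * z^2 * t^2
      + z^3 * (p * x + q * y) + t^3 * (p' * x + q' * y)" for x y z t
    by (simp add: nf A_def B_def)
  note odd = semi_invariant_R14_point[OF inv(3)]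
  have A0: "A x y = 0" for x y
    using odd[of x y 0 0] by (simp add: nfAB eq_neg_iff_add_eq_0 flip: mult_2)
  have c0: "c = 0"
    using odd[of 0 0 1 1] by (simp add: nfAB A0 B_def eq_neg_iff_add_eq_0 flip: mult_2)
  have BL: "B x y = 0 \<and> p' * x + q' * y = - (p * x + q * y)" for x y
  proof -
    have "2 * (B x y + (p * x + q * y) + (p' * x + q' * y)) = 0"
      using odd[of x y 1 1] by (simp add: nfAB A0 c0 algebra_simps eq_neg_iff_add_eq_0)
    moreover have "4 * B x y + 9 * (p * x + q * y) + 9 * (p' * x + q' * y) = 0"
      using odd[of x y 2 1]
    by (simp add: nfAB A0 c0; algebra?)
    ultimately have "B x y = 0" "p' * x + q' * y = - (p * x + q * y)" by algebra+
    then show ?thesis by blast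
  qed
  have ev: "eval4 g (vec4 x y z t) = (z^3 - t^3) * (p * x + q * y)" for x y z t
    using BL[of x y, THEN conjunct1] BL[of x y, THEN conjunct2] unfolding nfAB A0 c0 by algebra
  note r12 = invariant_R12_point[OF inv(2)]
  have "q = 0" using r12[of 0 0 1 0] by (simp add: ev)
  moreover have "p = 0" using r12[of 1 0 1 0] by (simp add: ev \<open>q = 0\<close>; algebra?)
  ultimately have "eval4 g v = 0" for v by (subst vec4_eta) (simp add: ev)
  then show False using g eval4_zero_imp_zero[of g] by (simp add: quartic_form_iff)
qed

text \<open>
  The matrix \<open>R12\<close> fixes the vector \<open>(1,1,1)\<close> in the coordinates \<open>y, z, t\<close> and negates the plane
  \<open>y + z + t = 0\<close>, so an invariant form is even on that plane; this and the images of the coordinate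
  vectors give the relations that do not involve \<open>\<surd>15\<close>. The reflection in \<open>R13\<close> gives the others. Two of the
  coefficients remain free.
\<close>

lemma invariant_pencil:
  assumes g: "quartic_form g" and inv: "semi_invariant g (R11 i s3) 1" "semi_invariant g R12 1"
    "semi_invariant g (R13 s3 s5) 1" "semi_invariant g R14 1"
  obtains lam mu where "g = Const lam * form_g0 s3 s5 + Const mu * form_g1"
proof -
  obtain a40 a31 a22 a13 a04 b20 b11 b02 c p q p' q' where
    nf: "\<And>x y z t. eval4 g (vec4 x y z t) = a40 * x^4 + a31 * x^3 * y + a22 * x^2 * y^2
      + a13 * x * y^3 + a04 * y^4 + (b20 * x^2 + b11 * x * y + b02 * y^2) * z * t + c * z^2 * t^2
      + z^3 * (p * x + q * y) + t^3 * (p' * x + q' * y)"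
    using normal_form_R11[OF g inv(1)] by blast
  note r12 = invariant_R12_point[OF inv(2)] and r13 = invariant_R13_point[OF inv(3)]
    and r14 = semi_invariant_R14_point[OF inv(4)]
  define s where "s = s3 * s5"
  have s: "s * s = 15" "s \<noteq> 0"
    using roots_nonzero by (simp_all add: s_def algebra_simps root_mult)
  then have s0: "s * s - 15 = 0" by simp
  have p': "p' = p" using r14[of 1 0 1 0] by (simp add: nf)
  have q': "q' = q" using r14[of 0 1 1 0] by (simp add: nf)
  \<comment> \<open>Vectors of the plane on which \<open>R12\<close> acts by -1.\<close>
  have a31: "a31 = 0" using r12[of 3 1 "-1" 0] r12[of 6 1 "-1" 0]
    by (simp add: nf; algebra?)
  have a13: "a13 = p" using r12[of 3 1 "-1" 0]
    by (simp add: nf a31; algebra?)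
  have b11: "b11 = - 3 * p" using r12[of 3 2 "-1" "-1"]
    by (simp add: nf a31 a13 p' q'; algebra?)
  \<comment> \<open>Images of the coordinate vectors under \<open>R12\<close>.\<close>
  have a04: "80 * a04 = 4 * b02 + 16 * c - 16 * q" using r12[of 0 1 0 0]
    by (simp add: nf a31 a13 p' q' b11; algebra?)
  have b20: "b20 = 2 * a22" using r12[of 1 1 0 0] r12[of "-1" 1 0 0] a04
    by (simp add: nf a31 a13 p' q' b11; algebra?)
  have c: "16 * a04 - 8 * b02 + 4 * c + 14 * q = 0" using r12[of 0 0 1 0]
    by (simp add: nf a31 a13 p' q' b11; algebra?)
  \<comment> \<open>The coefficient of \<open>x z^3\<close> is \<open>2 \<surd>15\<close> in \<open>g\<^sub>0\<close> and 0 in \<open>g\<^sub>1\<close>, which determines \<open>lam\<close>; the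
    coefficient of \<open>x^2 y^2\<close>, which is 13 and 2, then determines \<open>mu\<close>.\<close>
  define lam where "lam = s * p / 30"
  have lam: "30 * lam = s * p" by (simp add: lam_def)
  have p: "p = 2 * s * lam" using lam s0 by algebra
  have A: "a40 - s * a31 + a22 * s^2 - a13 * s^3 + a04 * s^4 = 256 * a40"
    using r13[of 1 0 0 0]
    unfolding s_def[symmetric] by (simp add: nf; algebra?)
  have "s * q = s * (10 * lam)" using r13[of 1 0 1 0] A s0
    unfolding s_def[symmetric] by (simp add: nf p' q' p; algebra?)
  then have q: "q = 10 * lam" using s(2) by simp
  have B: "b20 - s * b11 + b02 * s^2 = 16 * b20"
    using r13[of 1 0 1 1] r13[of 1 0 1 "-1"] A
    unfolding s_def[symmetric] by (simp add: nf p' q'; algebra?)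
  define mu where "mu = (a22 - 13 * lam) / 2"
  have a22: "a22 = 13 * lam + 2 * mu" by (simp add: mu_def field_simps)
  have b02: "b02 = 20 * lam + 4 * mu" using B s0 unfolding b20 b11 p a22 by algebra
  have a04': "a04 = mu" using a04 c unfolding b02 q by algebra
  have c': "c = 5 * lam + 4 * mu" using c unfolding b02 q a04' by algebra
  have a40: "a40 = - lam + mu" using A s0 unfolding a31 a13 a04' p a22 by algebra
  have "eval4 g v = eval4 (Const lam * form_g0 s3 s5 + Const mu * form_g1) v" for v
  proof -
    obtain x y z t where v: "v = vec4 x y z t" using vec4_eta by blast
    show ?thesis
      unfolding v nf form_g0_def form_g1_def Let_def eval4_simps vec4_nth s_def[symmetric]
        p' q' a31 a13 b11 b20 a22 b02 a04' c' a40 p q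
      by algebra
  qed
  then show thesis using that poly4_eqI by blast
qed

text \<open>
  The form is the square of the quadratic form \<open>x^2 + y^2 + 2 z t\<close>, and \<open>(1, i, 0, 0)\<close> is a zero of the latter.
\<close>

lemma form_g1_singular:
  "coeff (line_poly form_g1 (vec4 1 i 0 0) e) 0 = 0"
  "coeff (line_poly form_g1 (vec4 1 i 0 0) e) 1 = 0"
proof -
  note hom = comm_ring_map.map_simps[OF comm_ring_map_line_poly]
  have V: "line_poly (Var v) a e = [:a $ v, e $ v:]" for v a
    by (simp add: line_poly_def subst4_Var comm_ring_map_const_poly)
  define h where "h = [:1, e $ 1:]^2 + [:i, e $ 2:]^2 + 2 * [:0, e $ 3:] * [:0, e $ 4:]"
  have "line_poly form_g1 (vec4 1 i 0 0) e = h^2"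
    unfolding form_g1_def Let_def hom V vec4_nth h_def by algebra
  moreover have "coeff h 0 = 0"
    by (simp add: h_def power2_eq_square root_mult)
  ultimately show "coeff (line_poly form_g1 (vec4 1 i 0 0) e) 0 = 0"
    "coeff (line_poly form_g1 (vec4 1 i 0 0) e) 1 = 0"
    by (simp_all add: power2_eq_square coeff_mult)
qed

section \<open>Quartics invariant under the second group\<close>

text \<open>
  The sign of the multiplier of \<open>R24\<close> separates the two forms: with multiplier 1 it identifies five
  pairs of the 13 coefficients up to sign, and the remaining equations leave only the coefficient of \<open>x^4\<close> free.
\<close>

lemma R24_even_multiple_of_f0:
  assumes g: "quartic_form g" and inv: "semi_invariant g (R21 i s3) 1"
    "semi_invariant g (R22 s2 s3) 1" "semi_invariant g (R23 s3) 1" "semi_invariant g R24 1"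
  obtains lam where "g = Const lam * form_f0 s2 s3"
proof -
  obtain a40 a31 a22 a13 a04 b20 b11 b02 c p q p' q' where
    nf: "\<And>x y z t. eval4 g (vec4 x y z t) = a40 * x^4 + a31 * x^3 * y + a22 * x^2 * y^2
      + a13 * x * y^3 + a04 * y^4 + (b20 * x^2 + b11 * x * y + b02 * y^2) * z * t + c * z^2 * t^2
      + z^3 * (p * x + q * y) + t^3 * (p' * x + q' * y)"
    using normal_form_R11[OF g inv(1)[unfolded R21_def]] by blast
  note r22 = invariant_R22_point[OF g inv(2)] and r23 = invariant_R23_point[OF inv(3)]
    and r24 = semi_invariant_R24_point[OF inv(4)]
  have s0: "s2 * s2 - 2 = 0" "s3 * s3 - 3 = 0" by (simp_all add: root_mult)
  have a04: "a04 = a40" using r24[of 1 0 0 0] by (simp add: nf)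
  have a13: "a13 = - a31" using r24[of 1 1 0 0] r24[of 1 "-1" 0 0]
    by (simp add: nf a04; algebra?)
  have p': "p' = - q" using r24[of 0 1 1 0]
    by (simp add: nf a04; algebra?)
  have q': "q' = p" using r24[of 1 0 1 0]
    by (simp add: nf a04; algebra?)
  have b02: "b02 = - b20" using r24[of 1 0 1 1]
    by (simp add: nf a04 p' q'; algebra?)
  have p: "p = - s3 * q" using r23[of 0 1 1 0] r23[of 0 1 0 0] s0
    by (simp add: nf a04 p' q'; algebra?)
  have b20: "2 * b20 = s3 * b11" using r23[of 1 0 1 1] r23[of 1 0 1 "-1"] r23[of 1 0 0 0] s0
    by (simp add: nf a04 a13 b02 p' q' p; algebra?)
  have A: "6 * a40 = 2 * s3 * a31 + 3 * a22" using r23[of 1 0 0 0] s0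
    by (simp add: nf a04 a13; algebra?)
  have q: "q = - 2 * s2 * a40" using r22[of 1 0 0 0] s0
    by (simp add: nf a04 a13 p'; algebra?)
  have "8 * a22 = - 2 * b11 + 4 * c" using r22[of 1 1 0 0] s0
    by (simp add: nf a04 a13 b02 p' q' p q; algebra?)
  moreover have "8 * c = 4 * a22 - 2 * b11" using r22[of 0 0 1 1] s0
    by (simp add: nf a04 a13 b02 p' q' p q; algebra?)
  ultimately have a22: "a22 = c" and b11: "b11 = - 2 * c" by algebra+
  have C: "8 * s3 * a40 = s3 * c - a31" using r22[of 1 0 1 0] s0 b20
    by (simp add: nf a04 a13 b02 p' q' p q a22 b11; algebra?)
  have c: "c = 6 * a40" using A C s0 unfolding a22 by algebra
  have a31: "a31 = - 2 * s3 * a40" using C unfolding c by algebra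
  have b20': "b20 = - 6 * s3 * a40" using b20 unfolding b11 c by algebra
  have "eval4 g v = eval4 (Const a40 * form_f0 s2 s3) v" for v
  proof -
    obtain x y z t where v: "v = vec4 x y z t" using vec4_eta by blast
    show ?thesis
      unfolding v nf form_f0_def Let_def eval4_simps vec4_nth p' q' p q a04 a13 a22 a31 b02 b11 b20' c
      by algebra
  qed
  then show thesis using that poly4_eqI by blast
qed

text \<open>
  With multiplier -1 the monomials \<open>x^2 y^2\<close>, \<open>x y z t\<close> and \<open>z^2 t^2\<close> disappear, and again only the
  coefficient of \<open>x^4\<close> remains free.
\<close>

lemma R24_odd_multiple_of_f1:
  assumes g: "quartic_form g" and inv: "semi_invariant g (R21 i s3) 1"
    "semi_invariant g (R22 s2 s3) 1" "semi_invariant g (R23 s3) 1" "semi_invariant g R24 (-1)"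
  obtains lam where "g = Const lam * form_f1 s2 s3"
proof -
  obtain a40 a31 a22 a13 a04 b20 b11 b02 c p q p' q' where
    nf: "\<And>x y z t. eval4 g (vec4 x y z t) = a40 * x^4 + a31 * x^3 * y + a22 * x^2 * y^2
      + a13 * x * y^3 + a04 * y^4 + (b20 * x^2 + b11 * x * y + b02 * y^2) * z * t + c * z^2 * t^2
      + z^3 * (p * x + q * y) + t^3 * (p' * x + q' * y)"
    using normal_form_R11[OF g inv(1)[unfolded R21_def]] by blast
  note r22 = invariant_R22_point[OF g inv(2)] and r23 = invariant_R23_point[OF inv(3)]
    and r24 = semi_invariant_R24_point[OF inv(4)]
  define r where "r = s3 / 3"
  have s3: "s3 = 3 * r" by (simp add: r_def)
  have r: "3 * (r * r) = 1" by (simp add: r_def root_mult)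
  then have s0: "s2 * s2 - 2 = 0" "3 * (r * r) - 1 = 0" by (simp_all add: root_mult)
  have a04: "a04 = - a40" using r24[of 1 0 0 0] by (simp add: nf)
  have a22: "a22 = 0" using r24[of 1 1 0 0] by (simp add: nf a04; algebra?)
  have a13: "a13 = a31" using r24[of 2 1 0 0] by (simp add: nf a04 a22; algebra?)
  have p': "p' = q" using r24[of 0 1 1 0] by (simp add: nf a04; algebra?)
  have q': "q' = - p" using r24[of 1 0 1 0] by (simp add: nf a04; algebra?)
  have c: "c = 0" using r24[of 0 0 1 1] by (simp add: nf; algebra?)
  have b02: "b02 = b20" using r24[of 1 0 1 1] by (simp add: nf a04 c p' q'; algebra?)
  have b11: "b11 = 0" using r24[of 1 1 1 1] by (simp add: nf a04 a22 a13 b02 c p' q'; algebra?)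
  have a31: "a31 = 2 * r * a40" using r23[of 1 0 0 0] s0
    by (simp add: nf a04 a13 a22 s3; algebra?)
  have q: "q = 2 * s2 * a40" using r22[of 1 0 0 0] s0
    by (simp add: nf p'; algebra?)
  have p: "p = 2 * s2 * r * a40" using r23[of 0 1 1 0] r23[of 0 1 0 0] s0
    by (simp add: nf a04 p' q' q s3; algebra?)
  have b20: "b20 = 6 * r * a40" using r22[of 1 1 0 0] s0
    by (simp add: nf a04 a13 a22 a31 b02 b11 c p' q' p q; algebra?)
  have f: "2 / s3 = 2 * r" "2 * (s2 / s3) = 2 * s2 * r"
    using roots_nonzero by (simp_all add: r_def field_simps root_mult)
  have "eval4 g v = eval4 (Const a40 * form_f1 s2 s3) v" for v
  proof -
    obtain x y z t where v: "v = vec4 x y z t" using vec4_eta by blast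
    show ?thesis
      unfolding v nf form_f1_def Let_def eval4_simps vec4_nth f
        p' q' p q a04 a13 a22 a31 b02 b11 b20 c
      unfolding s3
      by algebra
  qed
  then show thesis using that poly4_eqI by blast
qed

section \<open>The three groups\<close>

lemma invertible_generators_1:
  "R \<in> {R11 i s3, R12, R13 s3 s5, R14} \<Longrightarrow> invertible R"
  using invertible_if_cube[OF R11_cube] invertible_if_square[OF R12_square]
    invertible_if_square[OF R13_square] invertible_if_square[OF R14_square]
  by (elim insertE emptyE) simp_all

lemma invertible_generators_2:
  "R \<in> {R21 i s3, R22 s2 s3, R23 s3, R24} \<Longrightarrow> invertible R"
  using invertible_if_cube[OF R11_cube] invertible_if_square[OF R22_square]
    invertible_if_square[OF R23_square] invertible_if_square[OF R24_square]
  by (elim insertE emptyE) (simp_all add: R21_def)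

lemma invertible_generators_3:
  "R \<in> {R31 i s3, R32 s2 s3, R33 i s2 s3 s5, R34} \<Longrightarrow> invertible R"
  using invertible_if_cube[OF R31_cube] invertible_if_square[OF R32_square]
    invertible_if_square[OF R33_square] invertible_if_square[OF R34_square]
  by (elim insertE emptyE) simp_all

lemma zero_locus_Const_mult: "c \<noteq> 0 \<Longrightarrow> zero_locus (Const c * f) = zero_locus f"
  by (simp add: zero_locus_def eval4_simps)

text \<open>
  All points \<open>(0,0,z,t)\<close> are singular in suitable coordinates; the point \<open>(0,0,1,0)\<close> is used.
\<close>

theorem S5_3_invariant_singular:
  fixes f :: "'k poly4"
  assumes f: "quartic_form f" and inv: "group_invariant (S5_3 i s2 s3 s5) (zero_locus f)"
  shows "\<not> nonsingular_form f"
proof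
  assume ns: "nonsingular_form f"
  obtain g where g: "quartic_form g"
    and semi: "\<forall>R\<in>{R31 i s3, R32 s2 s3, R33 i s2 s3 s5, R34}. \<exists>c. semi_invariant g R c"
    and smooth: "\<forall>a. a \<noteq> 0 \<longrightarrow>
      (\<exists>e. coeff (line_poly g a e) 0 \<noteq> 0 \<or> coeff (line_poly g a e) 1 \<noteq> 0)"
    using invariant_surface_normal_form[OF f ns inv[unfolded S5_3_def] invertible_generators_3]
    by metis
  obtain a d where a: "semi_invariant g (R31 i s3) a" and d: "semi_invariant g R34 d"
    using semi by auto
  have "a = 1"
    by (rule multiplier_order_3[OF g a d R31_cube R31_R34 R34_square]) simp
  then have "\<And>e. coeff (line_poly g (vec4 0 0 1 0) e) 0 = 0 \<and> coeff (line_poly g (vec4 0 0 1 0) e) 1 = 0"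
    using R31_invariant_double_line[OF g] a by blast
  moreover have "vec4 0 0 1 0 \<noteq> (0 :: 'k ^ 4)"
    by (simp add: vec_eq_iff forall_4)
  ultimately show False using smooth by blast
qed

text \<open>
  The member \<open>g\<^sub>1\<close> of the pencil, which \<open>g\<^sub>0 + \<lambda> g\<^sub>1\<close> misses, is a double quadric and is excluded by
  nonsingularity.
\<close>

theorem S5_1_invariant_nonsingular:
  fixes f :: "'k poly4"
  assumes f: "quartic_form f" "nonsingular_form f"
    and inv: "group_invariant (S5_1 i s3 s5) (zero_locus f)"
  shows "\<exists>lam. proj_equivalent (zero_locus f) (zero_locus (form_g0 s3 s5 + Const lam * form_g1))"
proof -
  obtain g where g: "quartic_form g" and pe: "proj_equivalent (zero_locus f) (zero_locus g)"
    and semi: "\<forall>R\<in>{R11 i s3, R12, R13 s3 s5, R14}. \<exists>c. semi_invariant g R c"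
    and smooth: "\<forall>a. a \<noteq> 0 \<longrightarrow>
      (\<exists>e. coeff (line_poly g a e) 0 \<noteq> 0 \<or> coeff (line_poly g a e) 1 \<noteq> 0)"
    using invariant_surface_normal_form[OF f inv[unfolded S5_1_def] invertible_generators_1]
    by metis
  obtain a b c d where a: "semi_invariant g (R11 i s3) a" and b: "semi_invariant g R12 b"
    and c: "semi_invariant g (R13 s3 s5) c" and d: "semi_invariant g R14 d"
    using semi by auto
  have "a = 1" and d1: "d = 1 \<or> d = -1"
    using multiplier_order_3[OF g a d R11_cube R11_R14 R14_square] by simp_all
  then have a1: "semi_invariant g (R11 i s3) 1" using a by simp
  have "b = 1" "c = 1"
    using multipliers_alternating[OF g a1 b c R12_square R13_square, of 1] R11_R12 R12_R13
    by (simp_all add: matrix_mul_lid)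
  then have b1: "semi_invariant g R12 1" and c1: "semi_invariant g (R13 s3 s5) 1"
    using b c by simp_all
  have "d = 1" using odd_R14_vanishes[OF g a1 b1] d d1 by blast
  then obtain lam mu where lm: "g = Const lam * form_g0 s3 s5 + Const mu * form_g1"
    using invariant_pencil[OF g a1 b1 c1] d by blast
  have "lam \<noteq> 0"
  proof
    assume "lam = 0"
    then have "g = Const mu * form_g1" by (simp add: lm Const_def)
    then have "line_poly g (vec4 1 i 0 0) e = [:mu:] * line_poly form_g1 (vec4 1 i 0 0) e" for e
      by (simp add: comm_ring_map.map_mult[OF comm_ring_map_line_poly])
        (simp add: line_poly_def subst4_Const comm_ring_map_const_poly)
    then have "\<And>e. coeff (line_poly g (vec4 1 i 0 0) e) 0 = 0
        \<and> coeff (line_poly g (vec4 1 i 0 0) e) 1 = 0"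
      using form_g1_singular by simp
    moreover have "vec4 1 i 0 0 \<noteq> 0" by (simp add: vec_eq_iff forall_4)
    ultimately show False using smooth by blast
  qed
  then have "Const mu = Const lam * Const (mu / lam)"
    by (simp flip: comm_ring_map.map_mult[OF comm_ring_map_Const])
  then have "g = Const lam * (form_g0 s3 s5 + Const (mu / lam) * form_g1)"
    by (simp add: lm algebra_simps)
  then have "zero_locus g = zero_locus (form_g0 s3 s5 + Const (mu / lam) * form_g1)"
    using \<open>lam \<noteq> 0\<close> by (simp add: zero_locus_Const_mult)
  then show ?thesis using pe by metis
qed

text \<open>
  Here the matrices generate \<open>\<^bold>S\<^sub>5\<close> only modulo scalars: the scalar \<open>-i\<close> enters a relation of the
  alternating group, and \<open>R24\<close> has square \<open>-1\<close>. Both have fourth power 1, which suffices for quartics.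
\<close>

theorem S5_2_invariant_nonsingular:
  fixes f :: "'k poly4"
  assumes f: "quartic_form f" "nonsingular_form f"
    and inv: "group_invariant (S5_2 i s2 s3) (zero_locus f)"
  shows "proj_equivalent (zero_locus f) (zero_locus (form_f0 s2 s3))
    \<or> proj_equivalent (zero_locus f) (zero_locus (form_f1 s2 s3))"
proof -
  obtain g where g: "quartic_form g" and pe: "proj_equivalent (zero_locus f) (zero_locus g)"
    and semi: "\<forall>R\<in>{R21 i s3, R22 s2 s3, R23 s3, R24}. \<exists>c. semi_invariant g R c"
    using invariant_surface_normal_form[OF f inv[unfolded S5_2_def] invertible_generators_2]
    by metis
  obtain a b c d where a: "semi_invariant g (R21 i s3) a" and b: "semi_invariant g (R22 s2 s3) b"
    and c: "semi_invariant g (R23 s3) c" and d: "semi_invariant g R24 d"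
    using semi by auto
  have "a = 1" and d1: "d = 1 \<or> d = -1"
    using multiplier_order_3[OF g a d R11_cube[folded R21_def] R21_R24 R24_square] by simp_all
  then have a1: "semi_invariant g (R21 i s3) 1" using a by simp
  have "(- i) ^ 4 = 1" by (simp add: power4_eq_xxxx root_mult)
  from multipliers_alternating[OF g a1 b c R22_square R23_square R21_R22 this R22_R23]
  have b1: "semi_invariant g (R22 s2 s3) 1" and c1: "semi_invariant g (R23 s3) 1"
    using b c by simp_all
  have "\<exists>lam. g = Const lam * form_f0 s2 s3 \<or> g = Const lam * form_f1 s2 s3"
    using d1 d R24_even_multiple_of_f0[OF g a1 b1 c1] R24_odd_multiple_of_f1[OF g a1 b1 c1] by metis
  then obtain lam where lam: "g = Const lam * form_f0 s2 s3 \<or> g = Const lam * form_f1 s2 s3"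
    by blast
  have "lam \<noteq> 0"
    using g lam by (auto simp: quartic_form_iff Const_def)
  then have "zero_locus g = zero_locus (form_f0 s2 s3) \<or> zero_locus g = zero_locus (form_f1 s2 s3)"
    using lam by (auto simp: zero_locus_Const_mult)
  then show ?thesis using pe by auto
qed

end

theorem proposition4p1:
  fixes i s2 s3 s5 :: "'k::{alg_closed_field, field_char_0}"
  assumes "i^2 = -1" and "s2^2 = 2" and "s3^2 = 3" and "s5^2 = 5"
  shows "(\<forall>f :: 'k poly4.
            quartic_form f \<and> group_invariant (S5_3 i s2 s3 s5) (zero_locus f)
            \<longrightarrow> \<not> nonsingular_form f)
       \<and> (\<forall>f :: 'k poly4.
            quartic_form f \<and> nonsingular_form f
              \<and> group_invariant (S5_1 i s3 s5) (zero_locus f)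
            \<longrightarrow> (\<exists>lam. proj_equivalent (zero_locus f)
                         (zero_locus (form_g0 s3 s5 + Const lam * form_g1))))
       \<and> (\<forall>f :: 'k poly4.
            quartic_form f \<and> nonsingular_form f
              \<and> group_invariant (S5_2 i s2 s3) (zero_locus f)
            \<longrightarrow> proj_equivalent (zero_locus f) (zero_locus (form_f0 s2 s3))
                \<or> proj_equivalent (zero_locus f) (zero_locus (form_f1 s2 s3)))"
proof -
  interpret root_choice i s2 s3 s5 by unfold_locales (fact assms)+
  show ?thesis
    using S5_3_invariant_singular S5_1_invariant_nonsingular S5_2_invariant_nonsingular by blast
qed

end
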